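(* Fix positive constants $A, A'$. Let $C(x)$ denote the number of Carmichael numbers $n \le x$ all of whose prime divisors $p$ satisfy $(p-1)/2 \in \mathcal{S}$. For each $E \in \mathcal{E} \cap (4/9,1)$, each $B \in \mathcal{B}(A,A')$ and each $\epsilon > 0$, there is a number $x_4(E,B,\epsilon)$ such that $C(x) \ge x^{EB - \epsilon}$ for all $x \ge x_4(E,B,\epsilon)$.
   Context: A Carmichael number is a composite positive integer $n$ with $a^n\equiv a \pmod n$ for all integers $a$. Let $\mathcal{S} = \{1,5,13,17,25,\dots\}$ be the multiplicative semigroup of positive integers generated by the primes $p \equiv 1 \pmod 4$, and $\mathbf{1}_{\mathcal{S}}$ its indicator function; $\mathbf{1}_{\mathbb{P}}$ is the indicator of the set of primes, $\pi(x)$ the prime counting function, $\phi$ Euler's function, $\mu$ the Möbius function, $P^+(n)$ the greatest prime divisor of $n$ ($P^+(1)=1$). Let $\log_1 x = \max\{1,\log x\}$ and $\log_2 x = \log_1(\log_1 x)$. Let $\pi(x,y) = \#\{p \in \mathcal{S}\cap[2,x] \text{ prime}: P^+(p-1)\le y\}$ (note primes in $\mathcal S$ are exactly the primes $\equiv 1 \pmod 4$). Let $\mathcal{E}$ be the set of $E \in (0,1)$ for which there exist $x_1(E), \gamma_1(E) > 0$ such that $\pi(x, x^{1-E}) \ge \gamma_1(E)\pi(x)$ for all $x \ge x_1(E)$. Exceptional modulus: let $c>0$ be a certain fixed small absolute constant for which the following holds (as shown by Banks–Freiberg–Maynard): for $T \ge 3$, among all primitive Dirichlet characters $\chi \bmod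 \ell$ with $\ell \le T$ and $P^+(\ell) \le T^{1/\log_2 T}$, at most one has $L(s,\chi)$ vanishing in the region $\mathrm{Re}(s) > 1 - c\log_2 T/\log T$, $|\mathrm{Im}(s)| \le \exp(\sqrt{\log T}/\log_2 T)$. If such a character $\chi \bmod \ell$ exists, set $\ell(T) = \ell$; otherwise set $\ell(T)=1$. For positive constants $A,A'$, let $\mathcal{B}(A,A')$ be the set of $B\in(0,1)$ for which there exists $x_2(B)$ such that for all $x\ge x_2(B)$, $$\frac{A^{-1} d x^{1-B} y^{-1}}{\phi(d)\log(d x^{1-B})} \le \sqrt{\log x}\sum_{\kappa \le x^{1-B}y^{-1}} \mathbf{1}_{\mathcal S}(\kappa)\mathbf{1}_{\mathbb P}(2d\kappa+1) \le \frac{A' d x^{1-B} y^{-1}}{\phi(d)\log(d x^{1-B})}$$ holds whenever $d \in \mathcal{S}\cap[1,x^B y]$, $|\mu(d)|=1$, $P^+(d) \le x^{B/\log_2 x}$, $y$ is a positive real with $y \le x^{B/\log_2 x}$, and $\gcd(d,\ell(x^B))=1$. *)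

theory Defs
  imports "HOL-Analysis.Analysis" "HOL-Number_Theory.Number_Theory"
    "HOL-Computational_Algebra.Squarefree"
begin

definition log1 :: "real \<Rightarrow> real" where
  "log1 x = max 1 (ln x)"

definition log2 :: "real \<Rightarrow> real" where
  "log2 x = log1 (log1 x)"

definition gpf :: "nat \<Rightarrow> nat" where
  "gpf n = (if n \<le> 1 then 1 else Max (prime_factors n))"

definition inS :: "nat \<Rightarrow> bool" where
  "inS n \<longleftrightarrow> n > 0 \<and> (\<forall>p \<in> prime_factors n. p mod 4 = 1)"

definition carmichael :: "nat \<Rightarrow> bool" where
  "carmichael n \<longleftrightarrow> n > 1 \<and> \<not> prime n \<and> (\<forall>a::int. [a ^ n = a] (mod int n))"

definition prime_pi :: "real \<Rightarrow> nat" where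
  "prime_pi x = card {p::nat. prime p \<and> real p \<le> x}"

definition pi_S :: "real \<Rightarrow> real \<Rightarrow> nat" where
  "pi_S x y = card {p::nat. prime p \<and> p mod 4 = 1 \<and> 2 \<le> real p \<and> real p \<le> x
                       \<and> real (gpf (p - 1)) \<le> y}"

definition E_set :: "real set" where
  "E_set = {E. 0 < E \<and> E < 1 \<and>
     (\<exists>x1 \<gamma>1. x1 > 0 \<and> \<gamma>1 > 0 \<and>
        (\<forall>x \<ge> x1. real (pi_S x (x powr (1 - E))) \<ge> \<gamma>1 * real (prime_pi x)))}"

definition dirichlet_char :: "nat \<Rightarrow> (nat \<Rightarrow> complex) \<Rightarrow> bool" where
  "dirichlet_char l chi \<longleftrightarrow> l \<ge> 1 \<and>
     (\<forall>m n. chi (m * n) = chi m * chi n) \<and>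
     (\<forall>n. chi (n + l) = chi n) \<and>
     (\<forall>n. chi n = 0 \<longleftrightarrow> \<not> coprime n l)"

text \<open>chi is primitive iff it is not induced by a character modulo any proper divisor d of l,
  i.e. for each proper divisor d there is n coprime to l, n = 1 mod d, with chi n \<noteq> 1.\<close>
definition primitive_char :: "nat \<Rightarrow> (nat \<Rightarrow> complex) \<Rightarrow> bool" where
  "primitive_char l chi \<longleftrightarrow> dirichlet_char l chi \<and>
     (\<forall>d. d dvd l \<and> d < l \<longrightarrow> (\<exists>n. coprime n l \<and> n mod d = 1 mod d \<and> chi n \<noteq> 1))"

text \<open>Vanishing of L(s,chi) for Re s > 0.  For l > 1 (non-principal primitive chi) the Dirichlet
  series converges for Re s > 0 and L(s,chi) is its sum.  For l = 1, L(s,chi) = zeta(s), and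
  in Re s > 0 we have (1 - 2^(1-s)) zeta(s) = eta(s) (the alternating series), so zeta(s) = 0
  iff eta(s) = 0 and 2^(1-s) \<noteq> 1.\<close>
definition L_vanishes :: "nat \<Rightarrow> (nat \<Rightarrow> complex) \<Rightarrow> complex \<Rightarrow> bool" where
  "L_vanishes l chi s \<longleftrightarrow>
     (if l = 1 then
        ((\<lambda>N. \<Sum>n=1..N. (-1) ^ (n + 1) / (of_nat n powr s)) \<longlonglongrightarrow> 0)
        \<and> (2::complex) powr (1 - s) \<noteq> 1
      else
        ((\<lambda>N. \<Sum>n=1..N. chi n / (of_nat n powr s)) \<longlonglongrightarrow> 0))"

definition exc_char :: "real \<Rightarrow> real \<Rightarrow> nat \<Rightarrow> (nat \<Rightarrow> complex) \<Rightarrow> bool" where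
  "exc_char c T l chi \<longleftrightarrow> primitive_char l chi \<and> real l \<le> T \<and>
     real (gpf l) \<le> T powr (1 / log2 T) \<and>
     (\<exists>s. Re s > 1 - c * log2 T / ln T \<and> \<bar>Im s\<bar> \<le> exp (sqrt (ln T) / log2 T)
          \<and> L_vanishes l chi s)"

text \<open>The Banks--Freiberg--Maynard property of c: at most one exceptional character.\<close>
definition BFM_const :: "real \<Rightarrow> bool" where
  "BFM_const c \<longleftrightarrow> 0 < c \<and> c < 1 \<and>
     (\<forall>T \<ge> 3. \<forall>l1 chi1 l2 chi2. exc_char c T l1 chi1 \<and> exc_char c T l2 chi2
        \<longrightarrow> l1 = l2 \<and> chi1 = chi2)"

definition exc_mod :: "real \<Rightarrow> real \<Rightarrow> nat" where
  "exc_mod c T = (if \<exists>l chi. exc_char c T l chi then (THE l. \<exists>chi. exc_char c T l chi) else 1)"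

definition B_set :: "real \<Rightarrow> real \<Rightarrow> real \<Rightarrow> real set" where
  "B_set c A A' = {B. 0 < B \<and> B < 1 \<and>
     (\<exists>x2. \<forall>x \<ge> x2. \<forall>(d::nat) (y::real).
        inS d \<and> real d \<le> x powr B * y \<and> squarefree d \<and>
        real (gpf d) \<le> x powr (B / log2 x) \<and> y > 0 \<and> y \<le> x powr (B / log2 x) \<and>
        coprime d (exc_mod c (x powr B))
        \<longrightarrow>
        (let K = (\<Sum>\<kappa>\<in>{1..nat \<lfloor>x powr (1 - B) / y\<rfloor>}.
                    (if inS \<kappa> \<and> prime (2 * d * \<kappa> + 1) then 1 else 0 :: real));
             M = real d * x powr (1 - B) / y / (real (totient d) * ln (real d * x powr (1 - B)))
         in inverse A * M \<le> sqrt (ln x) * K \<and> sqrt (ln x) * K \<le> A' * M))}"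

definition C_count :: "real \<Rightarrow> nat" where
  "C_count x = card {n::nat. real n \<le> x \<and> carmichael n \<and>
                      (\<forall>p \<in> prime_factors n. odd p \<and> inS ((p - 1) div 2))}"

end

theory Submission
  imports Defs "HOL-Real_Asymp.Real_Asymp"
begin

text \<open>
  This is the method of Alford, Granville and Pomerance. Let \<open>Q\<close> consist of primes \<open>q \<equiv> 1 (mod 4)\<close>
  up to \<open>y powr \<theta>\<close>, \<open>\<theta> = 1 / (1 - E)\<close>, with \<open>q - 1\<close> free of prime factors above \<open>y\<close> and \<open>q\<close> not
  dividing the exceptional modulus. By pigeonhole some \<open>k\<close> has many primes \<open>p = 2 * d * k + 1\<close> with
  \<open>d\<close> a product of elements of \<open>Q\<close>. These \<open>p\<close> are units modulo \<open>N = 2 * k * \<Prod>Q\<close> of small common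
  exponent, so every not too small set of them contains a subset of product \<open>1\<close> modulo \<open>N\<close>, and such
  a product is a Carmichael number by Korselt's criterion.

  Unlike in the original argument, \<open>k\<close> need not be coprime to \<open>\<Prod>Q\<close>: each common prime \<open>q\<close> only
  multiplies the exponent by \<open>q\<close>, so it suffices that \<open>k\<close> has at most \<open>y\<close> prime factors, which fails
  for a negligible proportion of \<open>k\<close>. With \<open>x = exp (y powr b)\<close>, \<open>X = exp (exp (y powr a))\<close> and
  \<open>1 < a < b\<close> close to \<open>1\<close>, products of about \<open>ln X / ln x\<close> of the primes give the bound at \<open>X\<close>.
\<close>

section \<open>Subproducts congruent to one\<close>

definition unity_root :: "nat \<Rightarrow> complex" where
  "unity_root m = cis (2 * pi / real m)"

lemma unity_root_pow_eq_1_iff: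
  assumes "m > 0"
  shows "unity_root m ^ k = 1 \<longleftrightarrow> m dvd k"
proof -
  have "unity_root m ^ k = exp (2 * of_real pi * \<i> * of_nat k / of_nat m)"
    unfolding unity_root_def cis_conv_exp
    by (subst exp_of_nat_mult[symmetric]) (simp add: field_simps)
  thus ?thesis
    using complex_root_unity_eq_1[of m k] assms by simp
qed

lemma sum_unity_root_powers:
  assumes "m > 0"
  shows "(\<Sum>j<m. unity_root m ^ (j * f)) = (if m dvd f then of_nat m else 0)"
proof (cases "m dvd f")
  case True
  hence "unity_root m ^ (j * f) = 1" for j
    using unity_root_pow_eq_1_iff[OF assms] by simp
  thus ?thesis using True by simp
next
  case False
  hence ne: "unity_root m ^ f \<noteq> 1"
    using unity_root_pow_eq_1_iff[OF assms] by simp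
  have "(\<Sum>j<m. unity_root m ^ (j * f)) = (\<Sum>j<m. (unity_root m ^ f) ^ j)"
    by (simp add: power_mult[symmetric] mult.commute)
  also have "\<dots> = ((unity_root m ^ f) ^ m - 1) / (unity_root m ^ f - 1)"
    using ne by (rule geometric_sum)
  also have "(unity_root m ^ f) ^ m = 1"
    using unity_root_pow_eq_1_iff[OF assms, of "f * m"] by (simp add: power_mult[symmetric])
  finally show ?thesis using False by simp
qed

text \<open>The group of maps from \<open>I\<close> to the integers modulo \<open>m\<close>.
  Extensionality makes the set finite and lets agreement on \<open>I\<close> imply equality.\<close>

definition exponent_vectors :: "'i set \<Rightarrow> nat \<Rightarrow> ('i \<Rightarrow> nat) set" where
  "exponent_vectors I m = (I \<rightarrow>\<^sub>E {..<m})"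

text \<open>The character with index \<open>z\<close>, evaluated at \<open>e\<close>. Exponents need
  not be reduced modulo \<open>m\<close>, so sums such as \<open>e i + f i\<close> can be inserted
  directly.\<close>

definition pairing :: "'i set \<Rightarrow> nat \<Rightarrow> ('i \<Rightarrow> nat) \<Rightarrow> ('i \<Rightarrow> nat) \<Rightarrow> complex" where
  "pairing I m z e = (\<Prod>i\<in>I. unity_root m ^ (z i * e i))"

text \<open>When \<open>R\<close> is a subgroup, this is the dual of the quotient by
  \<open>R\<close>.\<close>

definition annihilator :: "'i set \<Rightarrow> nat \<Rightarrow> ('i \<Rightarrow> nat) set \<Rightarrow> ('i \<Rightarrow> nat) set" where
  "annihilator I m R = {z \<in> exponent_vectors I m. \<forall>e\<in>R. pairing I m z e = 1}"

definition add_vectors :: "'i set \<Rightarrow> nat \<Rightarrow> ('i \<Rightarrow> nat) \<Rightarrow> ('i \<Rightarrow> nat) \<Rightarrow> 'i \<Rightarrow> nat" where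
  "add_vectors I m e e' = (\<lambda>i\<in>I. (e i + e' i) mod m)"

lemma finite_exponent_vectors: "finite I \<Longrightarrow> finite (exponent_vectors I m)"
  unfolding exponent_vectors_def by (intro finite_PiE) auto

lemma finite_annihilator: "finite I \<Longrightarrow> finite (annihilator I m R)"
  unfolding annihilator_def by (simp add: finite_exponent_vectors)

lemma pairing_add_right: "pairing I m z (\<lambda>i. e i + e' i) = pairing I m z e * pairing I m z e'"
  unfolding pairing_def by (simp add: prod.distrib[symmetric] power_add[symmetric] algebra_simps)

lemma unity_root_pow_mod:
  assumes "m > 0"
  shows "unity_root m ^ (a * (b mod m)) = unity_root m ^ (a * b)"
proof -
  have "a * b = a * (b mod m) + m * (a * (b div m))"
    by (metis mod_mult_div_eq distrib_left mult.left_commute)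
  hence "unity_root m ^ (a * b) = unity_root m ^ (a * (b mod m)) * (unity_root m ^ m) ^ (a * (b div m))"
    by (metis power_add power_mult)
  thus ?thesis using unity_root_pow_eq_1_iff[OF assms, of m] by simp
qed

lemma pairing_add_vectors:
  assumes "m > 0"
  shows "pairing I m z (add_vectors I m e e') = pairing I m z e * pairing I m z e'"
proof -
  have "pairing I m z (add_vectors I m e e') = pairing I m z (\<lambda>i. e i + e' i)"
    unfolding pairing_def add_vectors_def
    by (intro prod.cong refl) (simp add: unity_root_pow_mod[OF assms])
  thus ?thesis by (simp add: pairing_add_right)
qed

text \<open>The sum over all \<open>z\<close> factors over the coordinates, and each factor is a
  geometric sum over the \<open>m\<close>-th roots of unity.\<close>

lemma sum_pairing:
  assumes "finite I" "m > 0"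
  shows "(\<Sum>z\<in>exponent_vectors I m. pairing I m z f)
           = (if \<forall>i\<in>I. m dvd f i then of_nat m ^ card I else 0)"
proof -
  have "(\<Sum>z\<in>exponent_vectors I m. pairing I m z f) = (\<Prod>i\<in>I. \<Sum>j<m. unity_root m ^ (j * f i))"
    unfolding exponent_vectors_def pairing_def
    by (rule prod_sum_PiE[symmetric]) (use assms in auto)
  also have "\<dots> = (\<Prod>i\<in>I. if m dvd f i then of_nat m else 0)"
    by (simp add: sum_unity_root_powers[OF assms(2)])
  also have "\<dots> = (if \<forall>i\<in>I. m dvd f i then of_nat m ^ card I else 0)"
    using assms(1) by (auto simp: prod_zero_iff)
  finally show ?thesis .
qed

lemma inj_on_add_vectors:
  assumes "m > 0"
  shows "inj_on (\<lambda>e. add_vectors I m e e') (exponent_vectors I m)"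
proof (rule inj_onI)
  fix e1 e2 assume e: "e1 \<in> exponent_vectors I m" "e2 \<in> exponent_vectors I m"
    and eq: "add_vectors I m e1 e' = add_vectors I m e2 e'"
  show "e1 = e2"
  proof (rule PiE_ext)
    show "e1 \<in> I \<rightarrow>\<^sub>E {..<m}" "e2 \<in> I \<rightarrow>\<^sub>E {..<m}" using e by (auto simp: exponent_vectors_def)
    fix i assume i: "i \<in> I"
    have "[e1 i + e' i = e2 i + e' i] (mod m)"
      using fun_cong[OF eq, of i] i by (simp add: add_vectors_def cong_def)
    hence "[e1 i = e2 i] (mod m)"
      by (simp add: cong_add_rcancel_nat)
    thus "e1 i = e2 i"
      using e i by (auto simp: exponent_vectors_def cong_def PiE_def Pi_def)
  qed
qed

text \<open>Translation by an element \<open>e0\<close> on which the character is not 1 permutes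
  \<open>R\<close> and multiplies the sum by the value at \<open>e0\<close>, so the sum vanishes.
  Closure under addition suffices, because an injective self-map of a finite set is onto.\<close>

lemma sum_pairing_relations:
  assumes "finite I" "m > 0" and R: "R \<subseteq> exponent_vectors I m"
    and closed: "\<And>e e'. e \<in> R \<Longrightarrow> e' \<in> R \<Longrightarrow> add_vectors I m e e' \<in> R"
    and z: "z \<in> exponent_vectors I m"
  shows "(\<Sum>e\<in>R. pairing I m z e) = (if z \<in> annihilator I m R then of_nat (card R) else 0)"
proof (cases "z \<in> annihilator I m R")
  case True
  thus ?thesis by (simp add: annihilator_def)
next
  case False
  then obtain e0 where e0: "e0 \<in> R" "pairing I m z e0 \<noteq> 1"
    using z by (auto simp: annihilator_def)
  have finR: "finite R"
    using R finite_exponent_vectors[OF assms(1)] finite_subset by blast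
  have inj: "inj_on (\<lambda>e. add_vectors I m e e0) R"
    using inj_on_add_vectors[OF assms(2)] R inj_on_subset by blast
  have img: "(\<lambda>e. add_vectors I m e e0) ` R = R"
    by (rule endo_inj_surj[OF finR _ inj]) (use closed e0 in auto)
  have "(\<Sum>e\<in>R. pairing I m z e) = (\<Sum>e\<in>(\<lambda>e. add_vectors I m e e0) ` R. pairing I m z e)"
    by (simp only: img)
  also have "\<dots> = (\<Sum>e\<in>R. pairing I m z e * pairing I m z e0)"
    by (subst sum.reindex[OF inj]) (simp add: pairing_add_vectors[OF assms(2)])
  also have "\<dots> = (\<Sum>e\<in>R. pairing I m z e) * pairing I m z e0"
    by (simp add: sum_distrib_right)
  finally have "(\<Sum>e\<in>R. pairing I m z e) = 0"
    using e0(2) by auto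
  thus ?thesis using False by simp
qed

text \<open>Poisson summation: \<open>card R\<close> times the indicator of the annihilator is the
  character sum over \<open>R\<close>. After interchanging the sums, orthogonality over all
  \<open>z\<close> keeps only those \<open>e\<close> in \<open>R\<close> that are the negative of
  \<open>f\<close> modulo \<open>m\<close>.\<close>

lemma sum_pairing_annihilator:
  assumes "finite I" "m > 0" and R: "R \<subseteq> exponent_vectors I m"
    and closed: "\<And>e e'. e \<in> R \<Longrightarrow> e' \<in> R \<Longrightarrow> add_vectors I m e e' \<in> R"
  shows "of_nat (card R) * (\<Sum>z\<in>annihilator I m R. pairing I m z f)
           = of_nat (m ^ card I * card {e \<in> R. \<forall>i\<in>I. m dvd e i + f i})"
proof -
  let ?Z = "exponent_vectors I m"
  have finZ: "finite ?Z" using assms(1) by (rule finite_exponent_vectors)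
  have finR: "finite R" using finite_subset[OF R finZ] .
  have sub: "annihilator I m R \<subseteq> ?Z" by (auto simp: annihilator_def)
  have "of_nat (card R) * (\<Sum>z\<in>annihilator I m R. pairing I m z f)
          = (\<Sum>z\<in>?Z. (if z \<in> annihilator I m R then of_nat (card R) else 0) * pairing I m z f)"
  proof -
    have "(\<Sum>z\<in>?Z. (if z \<in> annihilator I m R then of_nat (card R) else 0) * pairing I m z f)
           = (\<Sum>z\<in>annihilator I m R. (if z \<in> annihilator I m R then of_nat (card R) else 0) * pairing I m z f)"
      by (rule sum.mono_neutral_right[OF finZ sub]) auto
    thus ?thesis by (simp add: sum_distrib_left)
  qed
  also have "\<dots> = (\<Sum>z\<in>?Z. (\<Sum>e\<in>R. pairing I m z e) * pairing I m z f)"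
    by (intro sum.cong refl) (simp add: sum_pairing_relations[OF assms])
  also have "\<dots> = (\<Sum>z\<in>?Z. \<Sum>e\<in>R. pairing I m z (\<lambda>i. e i + f i))"
    by (simp add: sum_distrib_right pairing_add_right)
  also have "\<dots> = (\<Sum>e\<in>R. \<Sum>z\<in>?Z. pairing I m z (\<lambda>i. e i + f i))"
    by (rule sum.swap)
  also have "\<dots> = (\<Sum>e\<in>R. if \<forall>i\<in>I. m dvd e i + f i then of_nat m ^ card I else 0)"
    by (simp add: sum_pairing[OF assms(1,2)])
  also have "\<dots> = of_nat (m ^ card I * card {e \<in> R. \<forall>i\<in>I. m dvd e i + f i})"
    by (simp add: sum.If_cases[OF finR] Int_def mult.commute)
  finally show ?thesis .
qed

text \<open>At each step some value of a coordinate is taken on at least a fraction \<open>1/m\<close> of the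
  vectors that are left; discard those vectors.\<close>
lemma greedy_cover:
  assumes "finite I" "m > 0" "\<Gamma> \<subseteq> exponent_vectors I m"
  shows "\<exists>v. real (card {z\<in>\<Gamma>. \<forall>i\<in>I. z i \<noteq> v i}) \<le> real (card \<Gamma>) * (1 - 1 / real m) ^ card I"
proof -
  have fin: "finite \<Gamma>"
    using assms finite_exponent_vectors finite_subset by blast
  have "\<exists>v. real (card {z\<in>\<Gamma>. \<forall>i\<in>K. z i \<noteq> v i}) \<le> real (card \<Gamma>) * (1 - 1 / real m) ^ card K"
    if "K \<subseteq> I" for K
    using finite_subset[OF that assms(1)] that
  proof (induction K rule: finite_induct)
    case empty
    thus ?case by simp
  next
    case (insert k K)
    then obtain v where v: "real (card {z\<in>\<Gamma>. \<forall>i\<in>K. z i \<noteq> v i}) \<le> real (card \<Gamma>) * (1 - 1 / real m) ^ card K"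
      by auto
    define \<Delta> where "\<Delta> = {z\<in>\<Gamma>. \<forall>i\<in>K. z i \<noteq> v i}"
    have fin\<Delta>: "finite \<Delta>" using fin by (simp add: \<Delta>_def)
    have "(\<Sum>j<m. card {z\<in>\<Delta>. z k = j}) = card (\<Union>j<m. {z\<in>\<Delta>. z k = j})"
      by (rule card_UN_disjoint[symmetric]) (use fin\<Delta> in auto)
    also have "(\<Union>j<m. {z\<in>\<Delta>. z k = j}) = \<Delta>"
      using assms(3) insert.prems by (fastforce simp: \<Delta>_def exponent_vectors_def)
    finally have total: "(\<Sum>j<m. card {z\<in>\<Delta>. z k = j}) = card \<Delta>" .
    have "\<exists>j<m. real (card \<Delta>) \<le> real m * real (card {z\<in>\<Delta>. z k = j})"
    proof (rule ccontr)
      assume "\<not> ?thesis"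
      hence "(\<Sum>j<m. real m * real (card {z\<in>\<Delta>. z k = j})) < (\<Sum>j<m. real (card \<Delta>))"
        using assms(2) by (intro sum_strict_mono) auto
      also have "(\<Sum>j<m. real m * real (card {z\<in>\<Delta>. z k = j})) = real m * real (card \<Delta>)"
        by (simp add: sum_distrib_left[symmetric] total[symmetric])
      finally show False by simp
    qed
    then obtain j where j: "real (card \<Delta>) \<le> real m * real (card {z\<in>\<Delta>. z k = j})" by blast
    have "{z\<in>\<Gamma>. \<forall>i\<in>insert k K. z i \<noteq> (v(k := j)) i} = \<Delta> - {z\<in>\<Delta>. z k = j}"
      using insert.hyps by (auto simp: \<Delta>_def)
    hence "real (card {z\<in>\<Gamma>. \<forall>i\<in>insert k K. z i \<noteq> (v(k := j)) i}) = real (card \<Delta>) - real (card {z\<in>\<Delta>. z k = j})"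
      using fin\<Delta> by (simp add: card_Diff_subset of_nat_diff card_mono)
    also have "\<dots> \<le> real (card \<Delta>) * (1 - 1 / real m)"
      using j assms(2) by (simp add: field_simps)
    also have "\<dots> \<le> (real (card \<Gamma>) * (1 - 1 / real m) ^ card K) * (1 - 1 / real m)"
      using v assms(2) by (intro mult_right_mono) (auto simp: \<Delta>_def)
    finally show ?case using insert.hyps by (intro exI[of _ "v(k := j)"]) (simp add: mult_ac)
  qed
  from this[of I] show ?thesis by simp
qed


section \<open>Multiplicative relations modulo \<open>N\<close> and the characters orthogonal to
  them\<close>

lemma cong_prod_power_mod:
  fixes a :: "'i \<Rightarrow> nat"
  assumes "\<And>i. i \<in> I \<Longrightarrow> [a i ^ m = 1] (mod N)"
  shows "[(\<Prod>i\<in>I. a i ^ (e i mod m)) = (\<Prod>i\<in>I. a i ^ e i)] (mod N)"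
proof (rule cong_prod)
  fix i assume "i \<in> I"
  have "[a i ^ (e i mod m) * (a i ^ m) ^ (e i div m) = a i ^ (e i mod m) * 1 ^ (e i div m)] (mod N)"
    using assms[OF \<open>i \<in> I\<close>] by (intro cong_mult cong_refl cong_pow)
  moreover have "a i ^ (e i mod m) * (a i ^ m) ^ (e i div m) = a i ^ e i"
    by (simp add: power_mult[symmetric] power_add[symmetric])
  ultimately show "[a i ^ (e i mod m) = a i ^ e i] (mod N)"
    by (simp add: cong_sym)
qed

lemma card_exponent_vectors: "finite I \<Longrightarrow> card (exponent_vectors I m) = m ^ card I"
  by (simp add: exponent_vectors_def card_PiE)

text \<open>The map sending \<open>e\<close> to the product of the \<open>a i ^ e i\<close> modulo
  \<open>N\<close> takes at most \<open>N\<close> values, and each nonempty fibre injects into the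
  set of relations by subtracting one of its members.\<close>

lemma exponent_vectors_le_card_relations:
  fixes a :: "'i \<Rightarrow> nat"
  assumes "finite I" "m > 0" "N > 0"
    and a: "\<And>i. i \<in> I \<Longrightarrow> [a i ^ m = 1] (mod N)"
  shows "m ^ card I \<le> N * card {e \<in> exponent_vectors I m. [(\<Prod>i\<in>I. a i ^ e i) = 1] (mod N)}"
proof -
  let ?Z = "exponent_vectors I m" and ?R = "{e \<in> exponent_vectors I m. [(\<Prod>i\<in>I. a i ^ e i) = 1] (mod N)}"
  let ?F = "\<lambda>e. (\<Prod>i\<in>I. a i ^ e i) mod N"
  have finZ: "finite ?Z" using assms(1) by (rule finite_exponent_vectors)
  have cop: "coprime (a i) N" if "i \<in> I" for i
  proof -
    have "coprime 1 N" by simp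
    hence "coprime (a i ^ m) N" by (rule cong_imp_coprime[OF cong_sym[OF a[OF that]]])
    thus ?thesis using \<open>m > 0\<close> by (simp only: coprime_power_left_iff) auto
  qed
  have fiber: "card {e\<in>?Z. ?F e = r} \<le> card ?R" for r
  proof (cases "{e\<in>?Z. ?F e = r} = {}")
    case True
    show ?thesis unfolding True by simp
  next
    case False
    then obtain e0 where e0: "e0 \<in> ?Z" "?F e0 = r" by auto
    \<comment> \<open>\<open>m - e0 i\<close> represents the negative of \<open>e0 i\<close>;
      truncated subtraction is harmless as \<open>e0 i < m\<close>.\<close>
    define e' where "e' = (\<lambda>i. m - e0 i)"
    have "inj_on (\<lambda>e. add_vectors I m e e') {e\<in>?Z. ?F e = r}"
      by (rule inj_on_subset[OF inj_on_add_vectors[OF assms(2)]]) auto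
    moreover have "add_vectors I m e e' \<in> ?R" if e: "e \<in> ?Z" "?F e = r" for e
    proof -
      have "add_vectors I m e e' \<in> ?Z"
        using assms(2) by (auto simp: add_vectors_def exponent_vectors_def)
      moreover have "[(\<Prod>i\<in>I. a i ^ add_vectors I m e e' i) = 1] (mod N)"
      proof -
        have "(\<Prod>i\<in>I. a i ^ add_vectors I m e e' i) = (\<Prod>i\<in>I. a i ^ ((e i + e' i) mod m))"
          by (intro prod.cong) (auto simp: add_vectors_def)
        hence 1: "[(\<Prod>i\<in>I. a i ^ add_vectors I m e e' i) = (\<Prod>i\<in>I. a i ^ (e i + e' i))] (mod N)"
          using cong_prod_power_mod[of I a m N "\<lambda>i. e i + e' i"] a by simp
        \<comment> \<open>Multiplying back by the product for \<open>e0\<close>, a unit modulo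
          \<open>N\<close>, turns each factor into \<open>a i ^ e i * a i ^ m\<close>; then the
          equal residues for \<open>e\<close> and \<open>e0\<close> cancel.\<close>
        have "(\<Prod>i\<in>I. a i ^ (e i + e' i)) * (\<Prod>i\<in>I. a i ^ e0 i) = (\<Prod>i\<in>I. a i ^ e i * a i ^ m)"
        proof -
          have le: "e0 i \<le> m" if "i \<in> I" for i
            using e0(1) that by (auto simp: exponent_vectors_def PiE_def Pi_def intro: less_imp_le)
          have sum_m: "e' i + e0 i = m" if "i \<in> I" for i
            using le[OF that] by (simp add: e'_def)
          thus ?thesis
            unfolding prod.distrib[symmetric]
            by (intro prod.cong refl) (simp add: add.assoc sum_m flip: power_add)
        qed
        also have "[(\<Prod>i\<in>I. a i ^ e i * a i ^ m) = (\<Prod>i\<in>I. a i ^ e i * 1)] (mod N)"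
          using a by (intro cong_prod cong_mult cong_refl)
        also have "[(\<Prod>i\<in>I. a i ^ e i * 1) = 1 * (\<Prod>i\<in>I. a i ^ e0 i)] (mod N)"
          using e e0 by (simp add: cong_def)
        finally have "[(\<Prod>i\<in>I. a i ^ (e i + e' i)) = 1] (mod N)"
          by (subst (asm) cong_mult_rcancel_nat) (use cop in \<open>auto intro!: prod_coprime_left\<close>)
        with 1 show ?thesis by (rule cong_trans)
      qed
      ultimately show ?thesis by simp
    qed
    ultimately show ?thesis
      by (intro card_inj_on_le[of "\<lambda>e. add_vectors I m e e'"]) (use finZ in auto)
  qed
  have "m ^ card I = card (\<Union>r<N. {e\<in>?Z. ?F e = r})"
    using assms(3) by (subst card_exponent_vectors[OF assms(1), symmetric]) (intro arg_cong[where f=card], auto)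
  also have "\<dots> \<le> (\<Sum>r<N. card {e\<in>?Z. ?F e = r})"
    by (rule card_UN_le) auto
  also have "\<dots> \<le> (\<Sum>r<N. card ?R)"
    by (intro sum_mono fiber)
  finally show ?thesis by simp
qed

text \<open>Let \<open>\<Gamma>\<close> be the vectors \<open>z\<close> of \<open>m\<close>-th roots of unity orthogonal to all multiplicative relations
  between the \<open>a i\<close>, i.e. the characters of the group they generate. If the roots \<open>v i\<close> are chosen
  greedily, \<open>\<Prod>i\<in>I. (v i - z i)\<close> vanishes on all of \<open>\<Gamma>\<close>; expanding the product and summing over \<open>\<Gamma>\<close>,
  only subsets with product \<open>1\<close> contribute, so the empty one cannot be alone.\<close>
lemma exists_unit_subproduct:
  fixes a :: "'i \<Rightarrow> nat"
  assumes fin: "finite I" and m: "m > 0" and N: "N > 0"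
    and a: "\<And>i. i \<in> I \<Longrightarrow> [a i ^ m = 1] (mod N)"
    and large: "real (card I) > real m * ln (real N)"
  shows "\<exists>J\<subseteq>I. J \<noteq> {} \<and> [(\<Prod>i\<in>J. a i) = 1] (mod N)"
proof (rule ccontr)
  assume contr: "\<not> ?thesis"
  define R where "R = {e \<in> exponent_vectors I m. [(\<Prod>i\<in>I. a i ^ e i) = 1] (mod N)}"
  define \<Gamma> where "\<Gamma> = annihilator I m R"
  have R: "R \<subseteq> exponent_vectors I m" by (auto simp: R_def)
  have closed: "add_vectors I m e e' \<in> R" if "e \<in> R" "e' \<in> R" for e e'
  proof -
    have "[(\<Prod>i\<in>I. a i ^ ((e i + e' i) mod m)) = (\<Prod>i\<in>I. a i ^ (e i + e' i))] (mod N)"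
      using a by (rule cong_prod_power_mod)
    also have "(\<Prod>i\<in>I. a i ^ (e i + e' i)) = (\<Prod>i\<in>I. a i ^ e i) * (\<Prod>i\<in>I. a i ^ e' i)"
      by (simp add: power_add prod.distrib)
    also have "[\<dots> = 1 * 1] (mod N)"
      using that by (intro cong_mult) (auto simp: R_def)
    finally have "[(\<Prod>i\<in>I. a i ^ add_vectors I m e e' i) = 1] (mod N)"
      by (simp add: add_vectors_def)
    thus ?thesis using m by (auto simp: R_def exponent_vectors_def add_vectors_def)
  qed
  have \<Gamma>_sub: "\<Gamma> \<subseteq> exponent_vectors I m" by (auto simp: \<Gamma>_def annihilator_def)
  have fin\<Gamma>: "finite \<Gamma>" using fin by (simp add: \<Gamma>_def finite_annihilator)
  have finR: "finite R" using finite_subset[OF R finite_exponent_vectors[OF fin]] .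
  have R0: "(\<lambda>i\<in>I. 0) \<in> R"
    using m by (auto simp: R_def exponent_vectors_def)
  hence cardR: "card R > 0" using finR by (auto simp: card_gt_0_iff)
  have orth: "(\<Sum>z\<in>\<Gamma>. pairing I m z f) * of_nat (card R) = of_nat (m ^ card I * card {e \<in> R. \<forall>i\<in>I. m dvd e i + f i})" for f
    using sum_pairing_annihilator[OF fin m R closed, of f] by (simp add: \<Gamma>_def mult.commute)
  \<comment> \<open>For \<open>f = 0\<close> the orthogonality relation counts only the zero vector.
    Hence \<open>card \<Gamma> * card R = m ^ card I\<close>, and the fibre bound turns this into
    \<open>card \<Gamma> \<le> N\<close>.\<close>
  have "{e \<in> R. \<forall>i\<in>I. m dvd e i + 0} = {\<lambda>i\<in>I. 0}"
  proof -
    have "e = (\<lambda>i\<in>I. 0)" if "e \<in> R" "\<forall>i\<in>I. m dvd e i" for e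
    proof (rule PiE_ext)
      show "e \<in> I \<rightarrow>\<^sub>E {..<m}" using that R by (auto simp: exponent_vectors_def)
      show "(\<lambda>i\<in>I. 0) \<in> I \<rightarrow>\<^sub>E {..<m}" using m by auto
      fix i assume i: "i \<in> I"
      have "e i < m" using that(1) R i by (auto simp: exponent_vectors_def)
      thus "e i = (\<lambda>i\<in>I. 0) i" using that(2) i nat_dvd_not_less[of "e i" m] by (metis gr0I restrict_apply')
    qed
    moreover have "(\<lambda>i\<in>I. 0) \<in> {e \<in> R. \<forall>i\<in>I. m dvd e i + 0}"
      using R0 by simp
    ultimately show ?thesis unfolding add_0_right by blast
  qed
  hence "of_nat (card \<Gamma>) * (of_nat (card R) :: complex) = of_nat (m ^ card I)"
    using orth[of "\<lambda>_. 0"] by (simp add: pairing_def)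
  hence card\<Gamma>: "card \<Gamma> * card R = m ^ card I"
    by (simp only: of_nat_mult[symmetric] of_nat_eq_iff)
  hence "card \<Gamma> > 0" using m by (cases "card \<Gamma> = 0") auto
  have "m ^ card I \<le> N * card R"
    unfolding R_def by (rule exponent_vectors_le_card_relations) (use assms in auto)
  hence "card \<Gamma> \<le> N" using card\<Gamma> cardR by (metis mult_le_cancel2)
  obtain v where v: "real (card {z\<in>\<Gamma>. \<forall>i\<in>I. z i \<noteq> v i}) \<le> real (card \<Gamma>) * (1 - 1 / real m) ^ card I"
    using greedy_cover[OF fin m \<Gamma>_sub] by blast
  \<comment> \<open>By \<open>1 - s \<le> exp (- s)\<close> and the size of \<open>I\<close>, fewer
    than one vector of \<Gamma> stays uncovered, so none does.\<close>
  have "(1 - 1 / real m) ^ card I \<le> exp (- 1 / real m) ^ card I"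
    using m exp_ge_add_one_self[of "- 1 / real m"] by (intro power_mono) auto
  also have "\<dots> = exp (- real (card I) / real m)"
    by (simp add: exp_of_nat_mult[symmetric])
  also have "\<dots> < exp (- ln (real N))"
    using large m by (simp add: field_simps)
  also have "\<dots> = 1 / real N" using N by (simp add: exp_minus field_simps)
  finally have "real (card \<Gamma>) * (1 - 1 / real m) ^ card I < real (card \<Gamma>) * (1 / real N)"
    using \<open>card \<Gamma> > 0\<close> by (intro mult_strict_left_mono) auto
  also have "\<dots> \<le> 1" using \<open>card \<Gamma> \<le> N\<close> N by (simp add: field_simps)
  finally have "card {z\<in>\<Gamma>. \<forall>i\<in>I. z i \<noteq> v i} = 0" using v by linarith
  hence covered: "\<exists>i\<in>I. z i = v i" if "z \<in> \<Gamma>" for z using fin\<Gamma> that by auto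
  let ?w = "unity_root m"
  have w0: "?w \<noteq> 0" by (simp add: unity_root_def)
  have "0 = (\<Sum>z\<in>\<Gamma>. \<Prod>i\<in>I. ?w ^ v i - ?w ^ z i)"
    using covered fin by (intro sum.neutral[symmetric]) (force simp: prod_zero_iff)
  also have "\<dots> = (\<Sum>z\<in>\<Gamma>. \<Sum>X\<in>Pow I. (-1) ^ card X * (\<Prod>i\<in>X. ?w ^ z i) * (\<Prod>i\<in>I-X. ?w ^ v i))"
    by (simp add: prod_diff_conv_sum[OF fin])
  also have "\<dots> = (\<Sum>X\<in>Pow I. (\<Sum>z\<in>\<Gamma>. (\<Prod>i\<in>X. ?w ^ z i)) * ((-1) ^ card X * (\<Prod>i\<in>I-X. ?w ^ v i)))"
    by (subst sum.swap) (simp add: sum_distrib_left sum_distrib_right mult_ac)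
  also have "\<dots> = (\<Sum>X\<in>Pow I. if X = {} then of_nat (card \<Gamma>) * (\<Prod>i\<in>I. ?w ^ v i) else 0)"
  proof (intro sum.cong refl)
    fix X assume X: "X \<in> Pow I"
    show "(\<Sum>z\<in>\<Gamma>. (\<Prod>i\<in>X. ?w ^ z i)) * ((-1) ^ card X * (\<Prod>i\<in>I-X. ?w ^ v i))
            = (if X = {} then of_nat (card \<Gamma>) * (\<Prod>i\<in>I. ?w ^ v i) else 0)"
    proof (cases "X = {}")
      case False
      \<comment> \<open>\<open>f\<close> is the indicator of \<open>X\<close>, which makes the
        product over \<open>X\<close> a character value. A relation \<open>e\<close> with
        \<open>e + f\<close> zero modulo \<open>m\<close> would force the product of
        \<open>a\<close> over \<open>X\<close> to be 1, against \<open>contr\<close>.\<close>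
      define f where "f = (\<lambda>i. if i \<in> X then 1 else 0 :: nat)"
      have "(\<Prod>i\<in>X. ?w ^ z i) = pairing I m z f" for z
      proof -
        have "pairing I m z f = (\<Prod>i\<in>I. if i \<in> X then ?w ^ z i else 1)"
          unfolding pairing_def f_def by (intro prod.cong) auto
        also have "\<dots> = (\<Prod>i\<in>X. ?w ^ z i)"
          using X fin by (subst prod.inter_restrict[symmetric]) (auto simp: Int_absorb1 inf_absorb2)
        finally show ?thesis by simp
      qed
      moreover have none: "{e \<in> R. \<forall>i\<in>I. m dvd e i + f i} = {}"
      proof (rule ccontr)
        assume "\<not> ?thesis"
        then obtain e where e: "e \<in> R" "\<forall>i\<in>I. m dvd e i + f i" by auto
        have "(\<Prod>i\<in>I. a i ^ e i) * (\<Prod>i\<in>X. a i) = (\<Prod>i\<in>I. a i ^ (e i + f i))"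
        proof -
          have "(\<Prod>i\<in>I. a i ^ f i) = (\<Prod>i\<in>I. if i \<in> X then a i else 1)"
            unfolding f_def by (intro prod.cong) auto
          also have "\<dots> = (\<Prod>i\<in>X. a i)"
            using X fin by (subst prod.inter_restrict[symmetric]) (auto simp: Int_absorb1 inf_absorb2)
          finally show ?thesis by (simp add: power_add prod.distrib)
        qed
        also have "[\<dots> = (\<Prod>i\<in>I. a i ^ ((e i + f i) mod m))] (mod N)"
          using a by (intro cong_sym[OF cong_prod_power_mod])
        also have "(\<Prod>i\<in>I. a i ^ ((e i + f i) mod m)) = 1"
          using e(2) by (intro prod.neutral) auto
        finally have 1: "[(\<Prod>i\<in>I. a i ^ e i) * (\<Prod>i\<in>X. a i) = 1] (mod N)" .
        have "[(\<Prod>i\<in>I. a i ^ e i) * (\<Prod>i\<in>X. a i) = 1 * (\<Prod>i\<in>X. a i)] (mod N)"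
          using e(1) by (intro cong_mult cong_refl) (auto simp: R_def)
        with 1 have "[(\<Prod>i\<in>X. a i) = 1] (mod N)" by (metis cong_sym cong_trans mult_1)
        with contr X False show False by auto
      qed
      ultimately have "(\<Sum>z\<in>\<Gamma>. (\<Prod>i\<in>X. ?w ^ z i)) * of_nat (card R) = 0"
        using orth[of f] unfolding none by simp
      thus ?thesis using False cardR by simp
    qed simp
  qed
  also have "\<dots> = of_nat (card \<Gamma>) * (\<Prod>i\<in>I. ?w ^ v i)"
    using fin by (simp add: sum.delta)
  finally show False using \<open>card \<Gamma> > 0\<close> w0 fin by (simp add: prod_zero_iff)
qed

section \<open>Counting subsets and Korselt's criterion\<close>

text \<open>Termwise \<open>card P choose j \<le> card P ^ j\<close>, and an extra factor
  \<open>n choose j \<ge> 1\<close> completes a binomial expansion.\<close>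

lemma card_subsets_le:
  assumes "finite P"
  shows "card {U. U \<subseteq> P \<and> card U \<le> n} \<le> (card P + 1) ^ n"
proof -
  have "{U. U \<subseteq> P \<and> card U \<le> n} = (\<Union>j\<le>n. {U. U \<subseteq> P \<and> card U = j})" by auto
  also have "card \<dots> \<le> (\<Sum>j\<le>n. card {U. U \<subseteq> P \<and> card U = j})"
    by (rule card_UN_le) auto
  also have "\<dots> = (\<Sum>j\<le>n. card P choose j)"
    by (simp add: n_subsets[OF assms])
  also have "\<dots> \<le> (\<Sum>j\<le>n. (n choose j) * card P ^ j)"
  proof (rule sum_mono)
    fix j assume "j \<in> {..n}"
    hence "n choose j \<ge> 1" by (simp add: Suc_le_eq zero_less_binomial)
    moreover have "card P choose j \<le> card P ^ j"
      by (cases "j \<le> card P") (auto simp: binomial_le_pow binomial_eq_0)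
    ultimately show "card P choose j \<le> (n choose j) * card P ^ j"
      using mult_le_mono by fastforce
  qed
  also have "\<dots> = (card P + 1) ^ n"
    using binomial[of "card P" 1 n] by simp
  finally show ?thesis .
qed

text \<open>Removing a maximal subset \<open>S\<close> of product \<open>1\<close> from a \<open>t\<close>-subset \<open>T\<close> leaves fewer than \<open>n\<close> elements,
  and \<open>T\<close> is recovered from \<open>S\<close> and the remainder.\<close>
lemma binomial_le_unit_subsets:
  fixes P :: "nat set"
  assumes fin: "finite P"
    and large: "\<And>U. U \<subseteq> P \<Longrightarrow> card U \<ge> n \<Longrightarrow> \<exists>J\<subseteq>U. J \<noteq> {} \<and> [\<Prod>J = 1] (mod N)"
  shows "card P choose t
    \<le> (card P + 1) ^ n * card {S. S \<subseteq> P \<and> [\<Prod>S = 1] (mod N) \<and> t \<le> card S + n \<and> card S \<le> t}"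
proof -
  let ?A = "{T. T \<subseteq> P \<and> card T = t}"
  let ?B = "{S. S \<subseteq> P \<and> [\<Prod>S = 1] (mod N) \<and> t \<le> card S + n \<and> card S \<le> t}"
  let ?C = "{U. U \<subseteq> P \<and> card U \<le> n}"
  have ex: "\<exists>S. S \<subseteq> T \<and> S \<in> ?B \<and> T - S \<in> ?C" if T: "T \<in> ?A" for T
  proof -
    have finT: "finite T" using T fin finite_subset by auto
    define F where "F = {S. S \<subseteq> T \<and> [\<Prod>S = 1] (mod N)}"
    have finF: "finite F" using finT by (auto simp: F_def)
    have "{} \<in> F" by (simp add: F_def)
    hence "Max (card ` F) \<in> card ` F" using finF by (intro Max_in) auto
    then obtain S where S: "S \<in> F" and "card S = Max (card ` F)" by auto
    hence max: "card S' \<le> card S" if "S' \<in> F" for S'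
      using finF that by simp
    have ST: "S \<subseteq> T" using S by (simp add: F_def)
    have "card (T - S) < n"
    proof (rule ccontr)
      assume "\<not> card (T - S) < n"
      then obtain J where J: "J \<subseteq> T - S" "J \<noteq> {}" "[\<Prod>J = 1] (mod N)"
        using large[of "T - S"] T by auto
      have fS: "finite S" "finite J" using ST J(1) finT finite_subset by blast+
      have "\<Prod>(S \<union> J) = \<Prod>S * \<Prod>J"
        by (rule prod.union_disjoint) (use fS J in auto)
      moreover have "[\<Prod>S * \<Prod>J = 1 * 1] (mod N)"
        using S J by (intro cong_mult) (auto simp: F_def)
      ultimately have "S \<union> J \<in> F" using ST J by (auto simp: F_def)
      moreover have "card (S \<union> J) = card S + card J"
        by (rule card_Un_disjoint) (use fS J in auto)
      moreover have "card J > 0" using J fS by (simp add: card_gt_0_iff)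
      ultimately show False using max by fastforce
    qed
    moreover have "card (T - S) = t - card S" "card S \<le> t"
      using T ST finT by (auto simp: card_Diff_subset finite_subset card_mono)
    ultimately show ?thesis using S T ST by (intro exI[of _ S]) (auto simp: F_def)
  qed
  obtain s where s: "\<And>T. T \<in> ?A \<Longrightarrow> s T \<subseteq> T \<and> s T \<in> ?B \<and> T - s T \<in> ?C"
    using that[of "\<lambda>T. SOME S. S \<subseteq> T \<and> S \<in> ?B \<and> T - S \<in> ?C"] someI_ex[OF ex] by blast
  have "inj_on (\<lambda>T. (s T, T - s T)) ?A"
  proof (rule inj_onI)
    fix T T' assume A: "T \<in> ?A" "T' \<in> ?A" and e: "(s T, T - s T) = (s T', T' - s T')"
    have eq: "s T = s T'" "T - s T = T' - s T'"
      using arg_cong[OF e, of fst] arg_cong[OF e, of snd] unfolding fst_conv snd_conv .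
    have "s T \<subseteq> T" "s T' \<subseteq> T'" using s A by blast+
    thus "T = T'" using eq by blast
  qed
  moreover have "(\<lambda>T. (s T, T - s T)) ` ?A \<subseteq> ?B \<times> ?C" using s by blast
  moreover have "finite (?B \<times> ?C)" using fin by simp
  ultimately have "card ?A \<le> card (?B \<times> ?C)" by (rule card_inj_on_le)
  also have "\<dots> = card ?C * card ?B" by (simp add: card_cartesian_product)
  also have "\<dots> \<le> (card P + 1) ^ n * card ?B"
    by (intro mult_right_mono card_subsets_le fin) simp
  finally show ?thesis by (simp add: n_subsets[OF fin])
qed

section \<open>Korselt's criterion for products of distinct primes\<close>

lemma prime_factors_Prod_primes:
  assumes "finite (S::nat set)" "\<And>p. p \<in> S \<Longrightarrow> prime p"
  shows "prime_factors (\<Prod>S) = S"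
proof -
  have "0 \<notin> S" using assms(2)[of 0] by auto
  hence "prime_factors (\<Prod>S) = (\<Union>p\<in>S. prime_factors p)"
    using prime_factors_prod[OF assms(1), of "\<lambda>x. x"] by simp
  thus ?thesis using assms(2) by (auto simp: prime_factorization_prime)
qed

text \<open>The congruence says that \<open>p - 1\<close> divides \<open>\<Prod>S - 1\<close>, so
  Fermat's theorem gives the claim modulo each \<open>p\<close>, and coprimality combines the
  primes. Having two prime factors rules out primality.\<close>

lemma carmichael_Prod:
  fixes S :: "nat set"
  assumes fin: "finite S" and pr: "\<And>p. p \<in> S \<Longrightarrow> prime p" and card: "card S \<ge> 2"
    and korselt: "\<And>p. p \<in> S \<Longrightarrow> [\<Prod>S = 1] (mod (p - 1))"
  shows "carmichael (\<Prod>S)"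
proof -
  let ?n = "\<Prod>S"
  have pf: "prime_factors ?n = S" using fin pr by (rule prime_factors_Prod_primes)
  have n0: "?n \<noteq> 0" using pr fin by (metis not_prime_0 prod_zero_iff)
  have "\<not> prime ?n"
  proof
    assume "prime ?n"
    hence "card S = 1" using pf by (metis prime_prime_factors is_singletonI is_singleton_altdef)
    thus False using card by simp
  qed
  moreover have "?n \<noteq> 1" using pf card by (metis card.empty not_numeral_le_zero prime_factorization_1 set_mset_empty)
  moreover have "[a ^ ?n = a] (mod int ?n)" for a :: int
  proof -
    have "[a ^ ?n = a] (mod int p)" if p: "p \<in> S" for p
    proof (cases "int p dvd a")
      case True
      hence "int p dvd a ^ ?n" using n0 by (meson dvd_power dvd_trans gr0I)
      thus ?thesis using True by (simp add: cong_def mod_eq_0_iff_dvd)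
    next
      case False
      have "(p - 1) dvd ?n - 1"
        using korselt[OF p] n0 by (metis cong_altdef_nat' cong_sym_eq One_nat_def Suc_leI gr0I cong_altdef_nat)
      then obtain k where k: "?n - 1 = (p - 1) * k" by blast
      have "p > 0" using pr[OF p] prime_gt_0_nat by blast
      \<comment> \<open>Fermat's theorem is applied to the natural residue of \<open>a\<close>,
        since \<open>a\<close> may be negative.\<close>
      hence b: "int (nat (a mod int p)) = a mod int p" by simp
      have "\<not> p dvd nat (a mod int p)"
        using False b by (metis dvd_mod_iff dvd_refl int_dvd_int_iff)
      hence "[nat (a mod int p) ^ (p - 1) = 1] (mod p)"
        using fermat_theorem pr[OF p] by blast
      hence "[(a mod int p) ^ (p - 1) = 1] (mod int p)"
        by (metis b cong_int_iff of_nat_1 of_nat_power)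
      hence "[a ^ (p - 1) = 1] (mod int p)"
        by (simp add: cong_def power_mod)
      hence "[(a ^ (p - 1)) ^ k * a = 1 ^ k * a] (mod int p)"
        by (intro cong_mult cong_pow cong_refl)
      moreover have "(a ^ (p - 1)) ^ k * a = a ^ ?n"
        using k n0 by (metis power_mult power_minus_mult gr0I)
      ultimately show ?thesis by simp
    qed
    hence "[a ^ ?n = a] (mod (\<Prod>p\<in>S. int p))"
      using pr by (intro cong_cong_prod_coprime) (auto simp: primes_coprime)
    thus ?thesis by simp
  qed
  ultimately show ?thesis using n0 by (simp add: carmichael_def)
qed

section \<open>Exponents and smooth numbers\<close>

lemma Prod_primes_dvd:
  fixes n :: nat
  assumes "finite S" "\<And>q. q \<in> S \<Longrightarrow> prime q" "\<And>q. q \<in> S \<Longrightarrow> q dvd n"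
  shows "\<Prod>S dvd n"
  using assms
proof (induction S rule: finite_induct)
  case (insert q S)
  have "coprime q (\<Prod>S)"
    using insert by (intro prod_coprime_right) (auto intro: primes_coprime)
  hence "q * \<Prod>S dvd n"
    using insert by (intro divides_mult) auto
  thus ?case using insert.hyps by simp
qed simp

text \<open>Since \<open>(a ^ g - 1) = (a - 1) * (\<Sum>i<g. a ^ i)\<close> and the sum is congruent to \<open>g\<close>, hence to \<open>0\<close>,
  modulo \<open>g\<close>.\<close>
lemma cong_power_one_lift:
  fixes a g M :: nat
  assumes "[a = 1] (mod M)" "g dvd M"
  shows "[a ^ g = 1] (mod g * M)"
proof -
  have 1: "[int a = 1] (mod int M)" using assms(1) by (metis cong_int_iff of_nat_1)
  have ag: "[int a = 1] (mod int g)"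
    using 1 assms(2) by (meson cong_dvd_modulus int_dvd_int_iff)
  have "[(\<Sum>i<g. int a ^ i) = (\<Sum>i<g. 1 ^ i)] (mod int g)"
    by (intro cong_sum cong_pow ag)
  hence "int g dvd (\<Sum>i<g. int a ^ i)"
    by (simp add: cong_def mod_eq_0_iff_dvd)
  moreover have "int M dvd int a - 1" using 1 by (simp add: cong_iff_dvd_diff)
  ultimately have "int g * int M dvd (\<Sum>i<g. int a ^ i) * (int a - 1)" by (rule mult_dvd_mono)
  hence "int g * int M dvd int a ^ g - 1" by (simp add: power_diff_1_eq mult.commute)
  hence "[int (a ^ g) = int 1] (mod int (g * M))" by (simp add: cong_iff_dvd_diff)
  thus ?thesis by (simp only: cong_int_iff)
qed

text \<open>Split \<open>\<Prod>Q\<close> into the part \<open>G\<close> of primes dividing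
  \<open>k\<close> and the part \<open>L\<close> of the others. The power \<open>G\<close> lifts
  \<open>p = 1\<close> from modulus \<open>2 * k\<close> to \<open>G * (2 * k)\<close>; modulo each
  prime of \<open>L\<close> Fermat's theorem applies, as \<open>q - 1\<close> divides
  \<open>l\<close>. The two moduli are coprime with product \<open>2 * k * \<Prod>Q\<close>.\<close>

lemma power_cong_one_modulus:
  fixes Q :: "nat set"
  assumes fin: "finite Q" and Q: "\<And>q. q \<in> Q \<Longrightarrow> prime q \<and> odd q \<and> (q - 1) dvd l"
    and p: "prime p" "p \<notin> Q" "[p = 1] (mod 2 * k)"
  shows "[p ^ (\<Prod>{q\<in>Q. q dvd k} * l) = 1] (mod 2 * k * \<Prod>Q)"
proof -
  define G where "G = \<Prod>{q\<in>Q. q dvd k}"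
  define L where "L = \<Prod>{q\<in>Q. \<not> q dvd k}"
  have "Q = {q\<in>Q. q dvd k} \<union> {q\<in>Q. \<not> q dvd k}" by auto
  hence "\<Prod>Q = \<Prod>({q\<in>Q. q dvd k} \<union> {q\<in>Q. \<not> q dvd k})" by simp
  also have "\<dots> = G * L" unfolding G_def L_def
    by (rule prod.union_disjoint) (use fin in auto)
  finally have GL: "\<Prod>Q = G * L" .
  have "G dvd k" unfolding G_def using fin Q by (intro Prod_primes_dvd) auto
  hence "[p ^ G = 1] (mod G * (2 * k))" using p(3) by (intro cong_power_one_lift) auto
  hence "[(p ^ G) ^ l = 1 ^ l] (mod G * (2 * k))" by (rule cong_pow)
  hence 1: "[p ^ (G * l) = 1] (mod G * (2 * k))" by (simp add: power_mult)
  have "[p ^ (G * l) = 1] (mod q)" if q: "q \<in> Q" for q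
  proof -
    have "\<not> q dvd p" using Q[OF q] p(1,2) q by (metis primes_dvd_imp_eq)
    hence f: "[p ^ (q - 1) = 1] (mod q)" using Q[OF q] by (intro fermat_theorem) auto
    obtain j where j: "l = (q - 1) * j" using Q[OF q] by auto
    have "[(p ^ (q - 1)) ^ (j * G) = 1 ^ (j * G)] (mod q)" using f by (rule cong_pow)
    thus ?thesis by (simp add: j power_mult[symmetric] mult_ac)
  qed
  hence 2: "[p ^ (G * l) = 1] (mod L)"
    unfolding L_def using Q by (intro cong_cong_prod_coprime_nat) (auto intro: primes_coprime)
  have "coprime (G * (2 * k)) L"
    unfolding L_def
  proof (intro prod_coprime_right)
    fix q assume "q \<in> {q\<in>Q. \<not> q dvd k}"
    hence q: "q \<in> Q" "\<not> q dvd k" by auto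
    have "\<not> q dvd 2" using Q[OF q(1)] by (metis two_is_prime_nat primes_dvd_imp_eq even_numeral dvd_refl)
    moreover have "\<not> q dvd G" using q(2) \<open>G dvd k\<close> dvd_trans by blast
    ultimately have "\<not> q dvd G * (2 * k)" using q Q[OF q(1)] by (simp add: prime_dvd_mult_iff)
    thus "coprime (G * (2 * k)) q" using Q[OF q(1)] by (metis coprime_commute prime_imp_coprime)
  qed
  hence "[p ^ (G * l) = 1] (mod G * (2 * k) * L)"
    using 1 2 by (intro coprime_cong_mult_nat[of _ _ "G * (2 * k)" L])
  thus ?thesis by (simp add: GL G_def[symmetric] mult_ac)
qed

lemma gpf_ge:
  assumes "p \<in> prime_factors n"
  shows "p \<le> gpf n"
proof -
  have "n \<noteq> 0" "n \<noteq> 1" using assms by (cases "n = 0"; auto)+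
  hence "\<not> n \<le> 1" by linarith
  thus ?thesis using assms by (simp add: gpf_def Max_ge)
qed

text \<open>The least common multiple of the \<open>q - 1\<close> serves as \<open>l\<close>: it is
  built from one prime power for each prime up to \<open>y\<close>, and every such power divides
  some \<open>q - 1\<close>, hence is at most \<open>z\<close>.\<close>

lemma exists_smooth_exponent:
  fixes y z :: real
  assumes y: "y \<ge> 1" and z: "z \<ge> 1"
    and Q: "finite Q" "\<And>q. q \<in> Q \<Longrightarrow> q \<ge> 2 \<and> real q \<le> z \<and> real (gpf (q - 1)) \<le> y"
  shows "\<exists>l>0. real l \<le> z powr y \<and> (\<forall>q\<in>Q. (q - 1) dvd l)"
proof (cases "Q = {}")
  case True
  thus ?thesis using z y by (intro exI[of _ 1]) (simp add: ge_one_powr_ge_zero)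
next
  case False
  \<comment> \<open>The highest exponent of \<open>p\<close> in any \<open>q - 1\<close>;
    \<open>Max\<close> asks for a nonempty set, whence the case distinction.\<close>
  define k where "k p = Max ((\<lambda>q. multiplicity p (q - 1)) ` Q)" for p :: nat
  define P where "P = {p. prime p \<and> p \<le> nat \<lfloor>y\<rfloor>}"
  define l where "l = (\<Prod>p\<in>P. p ^ k p)"
  have P_sub: "P \<subseteq> {1..nat \<lfloor>y\<rfloor>}" using prime_ge_1_nat by (auto simp: P_def)
  have finP: "finite P" using finite_subset[OF P_sub] by simp
  have "l > 0" unfolding l_def
    by (intro prod_pos) (auto simp: P_def prime_gt_0_nat)
  have kz: "real (p ^ k p) \<le> z" for p
  proof -
    have "k p \<in> (\<lambda>q. multiplicity p (q - 1)) ` Q"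
      unfolding k_def using Q(1) False by (intro Max_in) auto
    then obtain q where q: "q \<in> Q" "k p = multiplicity p (q - 1)" by auto
    have "p ^ k p dvd q - 1" using q by (simp add: multiplicity_dvd)
    hence "p ^ k p \<le> q - 1" using Q(2)[OF q(1)] by (intro dvd_imp_le) auto
    thus ?thesis using Q(2)[OF q(1)] by linarith
  qed
  have "real l = (\<Prod>p\<in>P. real (p ^ k p))" by (simp add: l_def)
  also have "\<dots> \<le> (\<Prod>p\<in>P. z)" by (intro prod_mono) (use kz in auto)
  also have "\<dots> = z ^ card P" by simp
  also have "\<dots> = z powr real (card P)" using z by (simp add: powr_realpow)
  also have "\<dots> \<le> z powr y"
  proof (intro powr_mono)
    have "card P \<le> card {1..nat \<lfloor>y\<rfloor>}" by (intro card_mono P_sub) simp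
    thus "real (card P) \<le> y" using y by simp linarith
  qed (use z in auto)
  finally have "real l \<le> z powr y" .
  moreover have "(q - 1) dvd l" if q: "q \<in> Q" for q
  proof -
    have "q - 1 \<noteq> 0" using Q(2)[OF q] by auto
    hence "q - 1 = (\<Prod>p\<in>prime_factors (q - 1). p ^ multiplicity p (q - 1))"
      using prime_factorization_nat by blast
    also have "\<dots> dvd l" unfolding l_def
    proof (rule prod_dvd_prod_subset2)
      show "prime_factors (q - 1) \<subseteq> P"
      proof
        fix p assume p: "p \<in> prime_factors (q - 1)"
        have "real p \<le> y" using gpf_ge[OF p] Q(2)[OF q] by linarith
        hence "p \<le> nat \<lfloor>y\<rfloor>" by linarith
        thus "p \<in> P" using p by (auto simp: P_def)
      qed
      fix p
      show "p ^ multiplicity p (q - 1) dvd p ^ k p"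
        unfolding k_def using Q(1) q by (intro le_imp_power_dvd Max_ge) auto
    qed (rule finP)
    finally show ?thesis .
  qed
  ultimately show ?thesis using \<open>l > 0\<close> by blast
qed

section \<open>Integers with many prime factors\<close>

lemma harm_le_ln:
  assumes "n > 0"
  shows "(harm n :: real) \<le> 1 + ln (real n)"
proof -
  have "harm (Suc (n - 1)) - ln (real (Suc (n - 1))) \<le> harm (Suc 0) - ln (real (Suc 0))"
    using decseq_harm_diff_ln by (rule decseqD) simp
  thus ?thesis using assms by (simp add: harm_expand)
qed

lemma card_multiples: "d > 0 \<Longrightarrow> card {k\<in>{1..n::nat}. d dvd k} \<le> n div d"
proof -
  assume d: "d > 0"
  have "{k\<in>{1..n}. d dvd k} \<subseteq> (\<lambda>j. d * j) ` {1..n div d}"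
  proof
    fix k assume k: "k \<in> {k\<in>{1..n}. d dvd k}"
    then obtain j where j: "k = d * j" by auto
    hence "j \<le> n div d" using k d by (simp add: less_eq_div_iff_mult_less_eq mult.commute)
    thus "k \<in> (\<lambda>j. d * j) ` {1..n div d}" using j k by (auto simp: Suc_le_eq)
  qed
  hence "card {k\<in>{1..n}. d dvd k} \<le> card ((\<lambda>j. d * j) ` {1..n div d})"
    by (intro card_mono) auto
  also have "\<dots> \<le> card {1..n div d}" by (rule card_image_le) simp
  finally show ?thesis by simp
qed

text \<open>Distinct sets of primes dividing \<open>k\<close> have distinct products, all of them
  divisors of \<open>k\<close>.\<close>

lemma two_pow_omega_le_divisors:
  assumes "k > (0::nat)"
  shows "2 ^ card (prime_factors k) \<le> card {d. d dvd k}"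
proof -
  have "card (Pow (prime_factors k)) \<le> card {d. d dvd k}"
  proof (rule card_inj_on_le)
    show "inj_on (\<lambda>S. \<Prod>S) (Pow (prime_factors k))"
    proof (rule inj_onI)
      fix S S' assume S: "S \<in> Pow (prime_factors k)" "S' \<in> Pow (prime_factors k)" "\<Prod>S = \<Prod>S'"
      have "finite S" "finite S'" using S(1,2) finite_subset by auto
      moreover have "prime p" if "p \<in> S \<or> p \<in> S'" for p using that S(1,2) by auto
      ultimately show "S = S'" using S(3) by (metis prime_factors_Prod_primes)
    qed
    show "(\<lambda>S. \<Prod>S) ` Pow (prime_factors k) \<subseteq> {d. d dvd k}"
    proof safe
      fix S assume S: "S \<subseteq> prime_factors k"
      show "\<Prod>S dvd k" by (rule Prod_primes_dvd) (use S finite_subset in auto)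
    qed
    show "finite {d. d dvd k}" using assms by simp
  qed
  thus ?thesis by (simp add: card_Pow)
qed

text \<open>A number with \<open>m\<close> prime factors has at least \<open>2 ^ m\<close> divisors,
  while the numbers up to \<open>n\<close> have at most \<open>n * harm n\<close> divisors in total.
  This makes cofactors with many prime factors negligible.\<close>

lemma card_many_prime_factors:
  assumes "n > 0"
  shows "2 ^ m * real (card {k\<in>{1..n}. m \<le> card (prime_factors k)}) \<le> real n * (1 + ln (real n))"
proof -
  have "2 ^ m * card {k\<in>{1..n}. m \<le> card (prime_factors k)} = (\<Sum>k\<in>{k\<in>{1..n}. m \<le> card (prime_factors k)}. 2 ^ m)"
    by simp
  also have "\<dots> \<le> (\<Sum>k\<in>{k\<in>{1..n}. m \<le> card (prime_factors k)}. card {d. d dvd k})"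
  proof (rule sum_mono)
    fix k assume k: "k \<in> {k\<in>{1..n}. m \<le> card (prime_factors k)}"
    have "(2::nat) ^ m \<le> 2 ^ card (prime_factors k)" using k by (intro power_increasing) auto
    also have "\<dots> \<le> card {d. d dvd k}" using k by (intro two_pow_omega_le_divisors) auto
    finally show "2 ^ m \<le> card {d. d dvd k}" .
  qed
  also have "\<dots> \<le> (\<Sum>k\<in>{1..n}. card {d. d dvd k})" by (rule sum_mono2) auto
  also have "\<dots> = (\<Sum>k\<in>{1..n}. card {d\<in>{1..n}. d dvd k})"
  proof (intro sum.cong refl arg_cong[where f=card] Collect_cong)
    fix k d assume "k \<in> {1..n}"
    thus "d dvd k \<longleftrightarrow> d \<in> {1..n} \<and> d dvd k"
      by (auto dest: dvd_imp_le dvd_pos_nat simp: Suc_le_eq)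
  qed
  also have "\<dots> = (\<Sum>k\<in>{1..n}. \<Sum>d\<in>{1..n}. if d dvd k then 1 else 0)"
    by (simp add: sum.If_cases Int_def)
  also have "\<dots> = (\<Sum>d\<in>{1..n}. \<Sum>k\<in>{1..n}. if d dvd k then 1 else 0)"
    by (rule sum.swap)
  also have "\<dots> = (\<Sum>d\<in>{1..n}. card {k\<in>{1..n}. d dvd k})"
    by (simp add: sum.If_cases Int_def)
  also have "\<dots> \<le> (\<Sum>d\<in>{1..n}. n div d)"
    by (intro sum_mono card_multiples) auto
  finally have "real (2 ^ m * card {k\<in>{1..n}. m \<le> card (prime_factors k)}) \<le> real (\<Sum>d\<in>{1..n}. n div d)"
    by (simp only: of_nat_le_iff)
  also have "\<dots> \<le> (\<Sum>d\<in>{1..n}. real n * inverse (real d))"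
    unfolding of_nat_sum
    by (intro sum_mono) (metis divide_inverse of_nat_div_le_of_nat)
  also have "\<dots> = real n * harm n" by (simp add: harm_def sum_distrib_left)
  also have "\<dots> \<le> real n * (1 + ln (real n))" using harm_le_ln[OF assms] by (intro mult_left_mono) auto
  finally show ?thesis by simp
qed

section \<open>From primes in a progression to Carmichael numbers\<close>

lemma inS_mult: "inS a \<Longrightarrow> inS b \<Longrightarrow> inS (a * b)"
  by (auto simp: inS_def prime_factors_product)

lemma inS_dvd_Prod:
  assumes "finite Q" "\<And>q. q \<in> Q \<Longrightarrow> prime q \<and> q mod 4 = 1" "d dvd \<Prod>Q"
  shows "inS d"
proof -
  have "\<Prod>Q \<noteq> 0" using assms(1,2) by (metis not_prime_0 prod_zero_iff)
  hence "prime_factors d \<subseteq> prime_factors (\<Prod>Q)" "d > 0"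
    using assms(3) by (auto simp: dvd_prime_factors intro!: Nat.gr0I)
  thus ?thesis using assms(1,2) prime_factors_Prod_primes[of Q] by (auto simp: inS_def)
qed

text \<open>With \<open>N = 2 * k * \<Prod>Q\<close>, each \<open>p - 1 = 2 * d * k\<close> divides
  \<open>N\<close>, so a product congruent to 1 modulo \<open>N\<close> meets Korselt's condition.
  The bound on \<open>n\<close> yields a unit subproduct among any \<open>n\<close> primes of
  \<open>P\<close>; \<open>t \<ge> n + 2\<close> leaves at least two primes in each product, and
  \<open>R ^ t \<le> X\<close> keeps the product at most \<open>X\<close>.\<close>

lemma C_count_lower_bound:
  fixes Q P :: "nat set"
  assumes finQ: "finite Q" and Q: "\<And>q. q \<in> Q \<Longrightarrow> prime q \<and> q mod 4 = 1 \<and> (q - 1) dvd l"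
    and l: "l > 0" and k: "inS k"
    and finP: "finite P"
    and P: "\<And>p. p \<in> P \<Longrightarrow> prime p \<and> p \<notin> Q \<and> real p \<le> R \<and> (\<exists>d. d dvd \<Prod>Q \<and> p = 2 * d * k + 1)"
    and n: "real n > real (\<Prod>{q\<in>Q. q dvd k} * l) * ln (real (2 * k * \<Prod>Q))"
    and t: "t \<ge> n + 2" and R: "R \<ge> 1" "R ^ t \<le> X"
  shows "card P choose t \<le> (card P + 1) ^ n * C_count X"
proof -
  define N where "N = 2 * k * \<Prod>Q"
  define B where "B = {S. S \<subseteq> P \<and> [\<Prod>S = 1] (mod N) \<and> t \<le> card S + n \<and> card S \<le> t}"
  have Qpos: "q > 0" "odd q" if "q \<in> Q" for q
  proof -
    have "q mod 4 = 1" using Q[OF that] by blast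
    thus "odd q" by presburger
    show "q > 0" using Q[OF that] by (simp add: prime_gt_0_nat)
  qed
  have "N > 0" using k Qpos finQ by (auto simp: N_def inS_def intro!: prod_pos)
  define m where "m = \<Prod>{q\<in>Q. q dvd k} * l"
  have "m > 0" using l Qpos by (auto simp: m_def intro!: prod_pos)
  have pm: "[p ^ m = 1] (mod N)" if p: "p \<in> P" for p
  proof -
    obtain d where "p = 2 * d * k + 1" using P[OF p] by blast
    hence "[p = 1] (mod 2 * k)" by (simp add: cong_altdef_nat)
    thus ?thesis unfolding m_def N_def
      using P[OF p] Q Qpos finQ by (intro power_cong_one_modulus) auto
  qed
  have "card P choose t \<le> (card P + 1) ^ n * card B"
    unfolding B_def
  proof (rule binomial_le_unit_subsets[OF finP])
    fix U assume U: "U \<subseteq> P" "card U \<ge> n"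
    have "real (card U) > real m * ln (real N)"
      using n U(2) by (simp add: m_def N_def)
    thus "\<exists>J\<subseteq>U. J \<noteq> {} \<and> [\<Prod>J = 1] (mod N)"
      using exists_unit_subproduct[of U m N "\<lambda>p. p"] U(1) finP pm \<open>m > 0\<close> \<open>N > 0\<close>
      by (meson finite_subset subsetD)
  qed
  also have "card B \<le> C_count X"
    unfolding C_count_def
  proof (rule card_inj_on_le)
    have prS: "finite S" "\<And>p. p \<in> S \<Longrightarrow> prime p" "S \<subseteq> P" if "S \<in> B" for S
      using that P finP finite_subset by (auto simp: B_def)
    show "inj_on (\<lambda>S. \<Prod>S) B"
      by (rule inj_onI) (metis prS prime_factors_Prod_primes)
    show "(\<lambda>S. \<Prod>S) ` B \<subseteq> {n. real n \<le> X \<and> carmichael n \<and> (\<forall>p\<in>prime_factors n. odd p \<and> inS ((p - 1) div 2))}"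
    proof safe
      fix S assume S: "S \<in> B"
      have cS: "[\<Prod>S = 1] (mod N)" "card S \<ge> 2" "card S \<le> t" using S t by (auto simp: B_def)
      have "real (\<Prod>S) = (\<Prod>p\<in>S. real p)" by simp
      also have "\<dots> \<le> (\<Prod>p\<in>S. R)" by (intro prod_mono) (use P prS[OF S] in auto)
      also have "\<dots> \<le> R ^ t" using R(1) cS(3) by (simp add: power_increasing)
      finally show "real (\<Prod>S) \<le> X" using R(2) by linarith
      show "carmichael (\<Prod>S)"
      proof (rule carmichael_Prod)
        fix p assume p: "p \<in> S"
        then obtain d where "d dvd \<Prod>Q" "p = 2 * d * k + 1" using P prS[OF S] by blast
        hence "(p - 1) dvd N" by (auto simp: N_def)
        thus "[\<Prod>S = 1] (mod (p - 1))" using cS(1) cong_dvd_modulus_nat by blast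
      qed (use prS[OF S] cS in auto)
      fix p assume "p \<in> prime_factors (\<Prod>S)"
      hence "p \<in> P" using prime_factors_Prod_primes[of S] prS[OF S] by auto
      then obtain d where d: "d dvd \<Prod>Q" "p = 2 * d * k + 1" using P by blast
      have "inS d" using finQ _ d(1) by (rule inS_dvd_Prod) (use Q in auto)
      moreover have "(p - 1) div 2 = d * k" using d(2) by simp
      ultimately show "inS ((p - 1) div 2)" using k by (simp add: inS_mult)
      show False if "even p" using that d(2) by simp
    qed
    \<comment> \<open>An infinite set would have cardinality 0 by convention, so the comparison
      requires finiteness.\<close>
    have "{n. real n \<le> X \<and> carmichael n \<and> (\<forall>p\<in>prime_factors n. odd p \<and> inS ((p - 1) div 2))} \<subseteq> {..nat \<lfloor>X\<rfloor>}"
      by (auto simp: le_nat_floor)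
    thus "finite {n. real n \<le> X \<and> carmichael n \<and> (\<forall>p\<in>prime_factors n. odd p \<and> inS ((p - 1) div 2))}"
      by (rule finite_subset) simp
  qed
  finally show ?thesis by (simp add: mult_left_mono)
qed

section \<open>Bounds from the hypotheses\<close>

text \<open>The lower bound for \<open>y = 1\<close>, simplified: \<open>totient d \<le> d\<close>
  removes the totient quotient, and \<open>d * x powr (1 - B) \<le> x\<close> bounds the logarithm
  by \<open>ln x\<close>. What is lost against \<open>x powr (1 - B)\<close> is a power of
  \<open>ln x\<close>.\<close>

lemma B_set_lower_bound:
  assumes A: "A > 0" and B: "B \<in> B_set c A A'"
  shows "\<exists>x0. \<forall>x\<ge>x0. \<forall>d. inS d \<and> squarefree d \<and> real d \<le> x powr B \<and>
           real (gpf d) \<le> x powr (B / log2 x) \<and> coprime d (exc_mod c (x powr B)) \<longrightarrow>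
           x powr (1 - B) \<le> A * (ln x * sqrt (ln x)) *
             real (card {k\<in>{1..nat \<lfloor>x powr (1 - B)\<rfloor>}. inS k \<and> prime (2 * d * k + 1)})"
proof -
  have B01: "0 < B" "B < 1" using B by (auto simp: B_set_def)
  obtain x2 where x2: "\<And>x d y. x \<ge> x2 \<Longrightarrow> 
        inS d \<and> real d \<le> x powr B * y \<and> squarefree d \<and>
        real (gpf d) \<le> x powr (B / log2 x) \<and> y > 0 \<and> y \<le> x powr (B / log2 x) \<and>
        coprime d (exc_mod c (x powr B)) \<Longrightarrow>
        (let K = (\<Sum>\<kappa>\<in>{1..nat \<lfloor>x powr (1 - B) / y\<rfloor>}.
                    (if inS \<kappa> \<and> prime (2 * d * \<kappa> + 1) then 1 else 0 :: real));
             M = real d * x powr (1 - B) / y / (real (totient d) * ln (real d * x powr (1 - B)))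
         in inverse A * M \<le> sqrt (ln x) * K \<and> sqrt (ln x) * K \<le> A' * M)"
    using B unfolding B_set_def by blast
  show ?thesis
  proof (intro exI[of _ "max x2 2"] allI impI)
    fix x :: real and d :: nat
    assume x: "max x2 2 \<le> x"
    assume d: "inS d \<and> squarefree d \<and> real d \<le> x powr B \<and>
           real (gpf d) \<le> x powr (B / log2 x) \<and> coprime d (exc_mod c (x powr B))"
    define K where "K = real (card {k\<in>{1..nat \<lfloor>x powr (1 - B)\<rfloor>}. inS k \<and> prime (2 * d * k + 1)})"
    define M where "M = real d * x powr (1 - B) / (real (totient d) * ln (real d * x powr (1 - B)))"
    have x1: "x > 1" using x by simp
    \<comment> \<open>This makes \<open>y = 1\<close> admissible: the upper limit for
      \<open>y\<close> is a nonnegative power of \<open>x\<close>.\<close>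
    have "log2 x \<ge> 1" by (simp add: log2_def log1_def)
    hence "1 \<le> x powr (B / log2 x)" using x1 B01 by (intro ge_one_powr_ge_zero) auto
    moreover have "(\<Sum>\<kappa>\<in>{1..nat \<lfloor>x powr (1 - B) / 1\<rfloor>}.
                    (if inS \<kappa> \<and> prime (2 * d * \<kappa> + 1) then 1 else 0 :: real)) = K"
      by (simp add: K_def sum.If_cases Int_def)
    ultimately have main: "inverse A * M \<le> sqrt (ln x) * K"
      using x2[of x d 1] x d unfolding M_def by (simp add: Let_def)
    have d0: "d > 0" using d by (auto simp: inS_def)
    have Z1: "x powr (1 - B) > 1" using x1 B01 by (simp add: gr_one_powr)
    have "real d * x powr (1 - B) \<ge> 1 * x powr (1 - B)" using d0 by (intro mult_right_mono) auto
    hence dZ: "real d * x powr (1 - B) > 1" using Z1 by linarith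
    have "real d * x powr (1 - B) \<le> x powr B * x powr (1 - B)" using d by (intro mult_right_mono) auto
    also have "\<dots> = x" using x1 by (simp add: powr_add[symmetric])
    finally have "ln (real d * x powr (1 - B)) \<le> ln x" using dZ x1 by simp
    moreover have lnpos: "ln (real d * x powr (1 - B)) > 0" using dZ by simp
    moreover have "real (totient d) \<le> real d" "real (totient d) > 0"
      using d0 by (auto simp: totient_le)
    ultimately have den: "real (totient d) * ln (real d * x powr (1 - B)) \<le> real d * ln x"
      by (intro mult_mono) auto
    have "x powr (1 - B) * (real (totient d) * ln (real d * x powr (1 - B))) \<le> x powr (1 - B) * (real d * ln x)"
      using den by (intro mult_left_mono) auto
    hence "x powr (1 - B) \<le> ln x * M"
      using lnpos \<open>real (totient d) > 0\<close> unfolding M_def by (simp add: field_simps)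
    also have "\<dots> \<le> ln x * (A * (sqrt (ln x) * K))"
      using main A x1 by (intro mult_left_mono) (auto simp: field_simps)
    finally show "x powr (1 - B) \<le> A * (ln x * sqrt (ln x)) *
             real (card {k\<in>{1..nat \<lfloor>x powr (1 - B)\<rfloor>}. inS k \<and> prime (2 * d * k + 1)})"
      by (simp add: K_def mult_ac)
  qed
qed

text \<open>Taking \<open>d = 1\<close> counts primes \<open>2 * k + 1\<close>, so the hypothesis on
  \<open>B\<close> itself gives a weak Chebyshev bound; powers of the logarithm are absorbed by
  \<open>z powr \<eta>\<close>.\<close>

lemma prime_pi_lower_bound:
  assumes A: "A > 0" and B: "B \<in> B_set c A A'" and \<eta>: "\<eta> > 0"
  shows "eventually (\<lambda>z. real (prime_pi z) \<ge> z powr (1 - \<eta>)) at_top"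
proof -
  have B01: "0 < B" "B < 1" using B by (auto simp: B_set_def)
  obtain x0 where x0: "\<And>x d. x \<ge> x0 \<Longrightarrow> inS d \<and> squarefree d \<and> real d \<le> x powr B \<and>
           real (gpf d) \<le> x powr (B / log2 x) \<and> coprime d (exc_mod c (x powr B)) \<Longrightarrow>
           x powr (1 - B) \<le> A * (ln x * sqrt (ln x)) *
             real (card {k\<in>{1..nat \<lfloor>x powr (1 - B)\<rfloor>}. inS k \<and> prime (2 * d * k + 1)})"
    using B_set_lower_bound[OF A B] by blast
  have "eventually (\<lambda>z. z powr (1 - \<eta>) * (A * (ln (z/3) / (1-B)) * sqrt (ln (z/3) / (1-B))) \<le> z / 3) at_top"
    using A B01 \<eta> by real_asymp
  moreover have "eventually (\<lambda>z. (z / 3) powr (1 / (1 - B)) \<ge> max x0 2) at_top"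
    using B01 by real_asymp
  moreover have "eventually (\<lambda>z::real. z > 6) at_top" by real_asymp
  ultimately show ?thesis
  proof eventually_elim
    case (elim z)
    \<comment> \<open>Chosen so that \<open>x powr (1 - B) = z / 3\<close>, which leaves room for
      \<open>2 * k + 1 \<le> z\<close>.\<close>
    define x where "x = (z / 3) powr (1 / (1 - B))"
    have x: "x \<ge> x0" "x \<ge> 2" using elim by (auto simp: x_def)
    have xB: "x powr (1 - B) = z / 3" using elim B01 by (simp add: x_def powr_powr)
    have lnx: "ln x = ln (z / 3) / (1 - B)" using elim by (simp add: x_def ln_powr)
    have lnpos: "ln x > 0" using x by simp
    have "log2 x \<ge> 1" by (simp add: log2_def log1_def)
    hence "1 \<le> x powr (B / log2 x)" "1 \<le> x powr B" using x B01 by (auto intro!: ge_one_powr_ge_zero)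
    hence "x powr (1 - B) \<le> A * (ln x * sqrt (ln x)) *
             real (card {k\<in>{1..nat \<lfloor>x powr (1 - B)\<rfloor>}. inS k \<and> prime (2 * 1 * k + 1)})"
      using x by (intro x0) (auto simp: inS_def gpf_def)
    also have "card {k\<in>{1..nat \<lfloor>x powr (1 - B)\<rfloor>}. inS k \<and> prime (2 * 1 * k + 1)} \<le> prime_pi z"
      unfolding prime_pi_def
    proof (rule card_inj_on_le)
      show "inj_on (\<lambda>k. 2 * k + 1) {k\<in>{1..nat \<lfloor>x powr (1 - B)\<rfloor>}. inS k \<and> prime (2 * 1 * k + 1)}"
        by (auto intro: inj_onI)
      show "(\<lambda>k. 2 * k + 1) ` {k\<in>{1..nat \<lfloor>x powr (1 - B)\<rfloor>}. inS k \<and> prime (2 * 1 * k + 1)} \<subseteq> {p. prime p \<and> real p \<le> z}"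
      proof safe
        fix k assume k: "k \<in> {1..nat \<lfloor>x powr (1 - B)\<rfloor>}"
        hence "real k \<le> z / 3" using elim unfolding xB by simp linarith
        thus "real (2 * k + 1) \<le> z" using elim by simp
      qed auto
      have "{p. prime p \<and> real p \<le> z} \<subseteq> {..nat \<lfloor>z\<rfloor>}" by (auto simp: le_nat_floor)
      thus "finite {p. prime p \<and> real p \<le> z}" by (rule finite_subset) simp
    qed
    finally have "z / 3 \<le> A * (ln x * sqrt (ln x)) * real (prime_pi z)"
      using A lnpos by (simp add: xB mult_left_mono)
    moreover have "z powr (1 - \<eta>) * (A * (ln x * sqrt (ln x))) \<le> z / 3"
      using elim by (simp add: lnx mult_ac)
    ultimately have "(A * (ln x * sqrt (ln x))) * z powr (1 - \<eta>) \<le> (A * (ln x * sqrt (ln x))) * real (prime_pi z)"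
      by (simp add: mult_ac)
    thus ?case by (rule mult_left_le_imp_le) (use A lnpos in simp)
  qed
qed

text \<open>The set counted by \<open>pi_S z y\<close>.\<close>

definition shifted_smooth_primes :: "real \<Rightarrow> real \<Rightarrow> nat set" where
  "shifted_smooth_primes z y = {q. prime q \<and> q mod 4 = 1 \<and> real q \<le> z \<and> real (gpf (q - 1)) \<le> y}"

lemma shifted_smooth_primes_subset: "shifted_smooth_primes z y \<subseteq> {1..nat \<lfloor>z\<rfloor>}"
  using prime_ge_1_nat by (auto simp: shifted_smooth_primes_def le_nat_floor)

lemma finite_shifted_smooth_primes: "finite (shifted_smooth_primes z y)"
  using shifted_smooth_primes_subset by (rule finite_subset) simp

text \<open>The exponent \<theta> is the one with \<open>(y powr \<theta>) powr (1 - E) = y\<close>,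
  so \<open>E_set\<close> supplies a positive proportion of the primes up to
  \<open>y powr \<theta>\<close>.\<close>

lemma card_shifted_smooth_primes_lower_bound:
  assumes A: "A > 0" and B: "B \<in> B_set c A A'" and E: "E \<in> E_set" and \<eta>: "\<eta> > 0"
    and \<theta>: "\<theta> = 1 / (1 - E)"
  shows "eventually (\<lambda>y. real (card (shifted_smooth_primes (y powr \<theta>) y)) \<ge> y powr (\<theta> - \<eta>)) at_top"
proof -
  obtain x1 \<gamma> where \<gamma>: "\<gamma> > 0" and E': "\<And>x. x \<ge> x1 \<Longrightarrow> real (pi_S x (x powr (1 - E))) \<ge> \<gamma> * real (prime_pi x)"
    using E unfolding E_set_def by blast
  have E01: "0 < E" "E < 1" using E by (auto simp: E_set_def)
  have \<theta>0: "\<theta> > 0" using E01 \<theta> by simp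
  \<comment> \<open>After multiplication by \<theta> the prime count loses the exponent
    \<open>\<eta> / 2\<close>; the other half absorbs the constant \<gamma>.\<close>
  have \<eta>': "\<eta> / (2 * \<theta>) > 0" using \<eta> \<theta>0 by simp
  have lim: "filterlim (\<lambda>y::real. y powr \<theta>) at_top at_top" using \<theta>0 by real_asymp
  have "eventually (\<lambda>y. real (prime_pi (y powr \<theta>)) \<ge> (y powr \<theta>) powr (1 - \<eta> / (2 * \<theta>))) at_top"
    using eventually_compose_filterlim[OF prime_pi_lower_bound[OF A B \<eta>'] lim] .
  moreover have "eventually (\<lambda>y. y powr \<theta> \<ge> x1) at_top" using lim by (simp add: filterlim_at_top)
  moreover have "eventually (\<lambda>y. \<gamma> * y powr (\<theta> - \<eta> / 2) \<ge> y powr (\<theta> - \<eta>)) at_top"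
    using \<gamma> \<eta> by real_asymp
  moreover have "eventually (\<lambda>y::real. y > 0) at_top" by real_asymp
  ultimately show ?thesis
  proof eventually_elim
    case (elim y)
    have "(y powr \<theta>) powr (1 - E) = y" using elim \<theta> E01 by (simp add: powr_powr)
    moreover have "{p::nat. prime p \<and> p mod 4 = 1 \<and> 2 \<le> real p \<and> real p \<le> y powr \<theta>
                       \<and> real (gpf (p - 1)) \<le> y} = shifted_smooth_primes (y powr \<theta>) y"
      unfolding shifted_smooth_primes_def using prime_ge_2_nat by fastforce
    ultimately have card: "real (card (shifted_smooth_primes (y powr \<theta>) y)) \<ge> \<gamma> * real (prime_pi (y powr \<theta>))"
      using E'[OF elim(2)] by (simp add: pi_S_def)
    have "\<theta> * (1 - \<eta> / (2 * \<theta>)) = \<theta> - \<eta> / 2" using \<theta>0 by (simp add: field_simps)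
    hence "real (prime_pi (y powr \<theta>)) \<ge> y powr (\<theta> - \<eta> / 2)" using elim by (simp add: powr_powr)
    hence "\<gamma> * real (prime_pi (y powr \<theta>)) \<ge> \<gamma> * y powr (\<theta> - \<eta> / 2)"
      using \<gamma> by (intro mult_left_mono) auto
    thus ?case using card elim(3) by linarith
  qed
qed

text \<open>\<open>THE\<close> denotes an actual modulus because \<open>BFM_const\<close> allows
  only one exceptional character. The bounds limit how many primes must be avoided.\<close>

lemma exc_mod_bounds:
  assumes "BFM_const c" "T \<ge> 3"
  shows "exc_mod c T \<ge> 1" "real (exc_mod c T) \<le> T"
proof -
  have "exc_mod c T \<ge> 1 \<and> real (exc_mod c T) \<le> T"
  proof (cases "\<exists>l chi. exc_char c T l chi")
    case True
    then obtain l chi where l: "exc_char c T l chi" by blast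
    have "exc_mod c T = (THE l. \<exists>chi. exc_char c T l chi)" using True by (simp add: exc_mod_def)
    also have "\<dots> = l"
      using l assms unfolding BFM_const_def by (intro the_equality) blast+
    finally show ?thesis using l by (simp add: exc_char_def primitive_char_def dirichlet_char_def)
  next
    case False
    thus ?thesis using assms(2) by (simp add: exc_mod_def)
  qed
  thus "exc_mod c T \<ge> 1" "real (exc_mod c T) \<le> T" by auto
qed

text \<open>The product of the distinct primes is at least 2 to their number and at most
  \<open>n\<close>; the constant comes from \<open>ln 2 \<ge> 1 / 2\<close>.\<close>

lemma card_prime_factors_le_ln:
  assumes "n > (0::nat)"
  shows "real (card (prime_factors n)) \<le> 2 * ln (real n)"
proof -
  have "(2::nat) ^ card (prime_factors n) = (\<Prod>p\<in>prime_factors n. 2)" by simp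
  also have "\<dots> \<le> \<Prod>(prime_factors n)"
    by (intro prod_mono) (auto dest: in_prime_factors_imp_prime prime_ge_2_nat)
  also have "\<dots> \<le> n"
    using assms by (intro dvd_imp_le Prod_primes_dvd) auto
  finally have "real (2 ^ card (prime_factors n)) \<le> real n" by (simp only: of_nat_le_iff)
  hence "ln (real (2 ^ card (prime_factors n))) \<le> ln (real n)"
    using assms by (subst ln_le_cancel_iff) auto
  hence "real (card (prime_factors n)) * ln 2 \<le> ln (real n)" by (simp add: ln_realpow)
  moreover have "ln (2::real) \<ge> 1 / 2" using ln2_ge_two_thirds by linarith
  hence "real (card (prime_factors n)) * (1 / 2) \<le> real (card (prime_factors n)) * ln 2"
    by (intro mult_left_mono) auto
  ultimately show ?thesis by linarith
qed

section \<open>Many primes in one progression\<close>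

text \<open>Double counting of the pairs related by \<open>R\<close>: some \<open>k\<close> has at
  least the average number of \<open>d\<close>.\<close>

lemma exists_popular_element:
  fixes D :: "'a set" and G :: "'b set"
  assumes fin: "finite D" "finite G" and ne: "G \<noteq> {}"
    and R: "\<And>d. d \<in> D \<Longrightarrow> s \<le> real (card {k\<in>G. R d k})"
  shows "\<exists>k\<in>G. s * real (card D) \<le> real (card G) * real (card {d\<in>D. R d k})"
proof (rule ccontr)
  assume "\<not> ?thesis"
  hence "(\<Sum>k\<in>G. real (card G) * real (card {d\<in>D. R d k})) < (\<Sum>k\<in>G. s * real (card D))"
    using fin ne by (intro sum_strict_mono) (auto simp: not_le)
  hence "real (card G) * (\<Sum>k\<in>G. real (card {d\<in>D. R d k})) < real (card G) * (s * real (card D))"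
    by (simp add: sum_distrib_left)
  hence "(\<Sum>k\<in>G. real (card {d\<in>D. R d k})) < s * real (card D)"
    by (rule mult_left_less_imp_less) simp
  also have "s * real (card D) = (\<Sum>d\<in>D. s)" by simp
  also have "\<dots> \<le> (\<Sum>d\<in>D. real (card {k\<in>G. R d k}))" by (intro sum_mono R)
  also have "\<dots> = (\<Sum>d\<in>D. \<Sum>k\<in>G. if R d k then 1 else 0)"
    using fin by (simp add: sum.If_cases Int_def)
  also have "\<dots> = (\<Sum>k\<in>G. \<Sum>d\<in>D. if R d k then 1 else 0)" by (rule sum.swap)
  also have "\<dots> = (\<Sum>k\<in>G. real (card {d\<in>D. R d k}))"
    using fin by (simp add: sum.If_cases Int_def)
  finally show False by simp
qed

section \<open>Products of a fixed number of primes from \<open>Q\<close>\<close>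

definition prime_products :: "nat set \<Rightarrow> nat \<Rightarrow> nat set" where
  "prime_products Q u = (\<lambda>S. \<Prod>S) ` {S. S \<subseteq> Q \<and> card S = u}"

lemma finite_prime_products: "finite Q \<Longrightarrow> finite (prime_products Q u)"
  by (simp add: prime_products_def)

lemma card_prime_products:
  assumes "finite Q" "\<And>q. q \<in> Q \<Longrightarrow> prime q"
  shows "card (prime_products Q u) = card Q choose u"
proof -
  have "inj_on (\<lambda>S. \<Prod>S) {S. S \<subseteq> Q \<and> card S = u}"
  proof (rule inj_onI)
    fix S S' assume S: "S \<in> {S. S \<subseteq> Q \<and> card S = u}" "S' \<in> {S. S \<subseteq> Q \<and> card S = u}" "\<Prod>S = \<Prod>S'"
    have "finite S" "finite S'" using S assms(1) finite_subset by auto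
    moreover have "prime p" if "p \<in> S \<or> p \<in> S'" for p using that S assms(2) by auto
    ultimately show "S = S'" using S(3) by (metis prime_factors_Prod_primes)
  qed
  thus ?thesis unfolding prime_products_def by (simp add: card_image n_subsets[OF assms(1)])
qed

lemma squarefree_Prod_primes:
  fixes S :: "nat set"
  assumes "finite S" "\<And>q. q \<in> S \<Longrightarrow> prime q"
  shows "squarefree (\<Prod>S)"
  using assms by (intro squarefree_prod_coprime) (auto intro: primes_coprime squarefree_prime)

text \<open>Collects what \<open>B_set_lower_bound\<close> asks of \<open>d\<close>, with
  \<open>e\<close> in the role of the exceptional modulus; divisibility of \<open>\<Prod>Q\<close>
  serves Korselt's condition later.\<close>

lemma prime_products_properties:
  fixes z :: real
  assumes fin: "finite Q" and Q: "\<And>q. q \<in> Q \<Longrightarrow> prime q \<and> q mod 4 = 1 \<and> real q \<le> z \<and> \<not> q dvd e"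
    and z: "z \<ge> 1" and d: "d \<in> prime_products Q u"
  shows "inS d" "squarefree d" "real d \<le> z ^ u" "real (gpf d) \<le> z" "coprime d e" "d dvd \<Prod>Q"
proof -
  obtain S where S: "S \<subseteq> Q" "card S = u" "d = \<Prod>S" using d by (auto simp: prime_products_def)
  have finS: "finite S" using S fin finite_subset by blast
  have pr: "\<And>q. q \<in> S \<Longrightarrow> prime q" using S Q by blast
  show dvd: "d dvd \<Prod>Q" unfolding S(3) by (rule prod_dvd_prod_subset) (use S fin in auto)
  show "inS d" by (rule inS_dvd_Prod[OF fin _ dvd]) (use Q in auto)
  show "squarefree d" unfolding S(3) using finS pr by (rule squarefree_Prod_primes)
  have "real d = (\<Prod>q\<in>S. real q)" by (simp add: S(3))
  also have "\<dots> \<le> (\<Prod>q\<in>S. z)" by (intro prod_mono) (use Q S in auto)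
  finally show "real d \<le> z ^ u" using S(2) by simp
  show "real (gpf d) \<le> z"
  proof (cases "d \<le> 1")
    case False
    have pf: "prime_factors d = S" unfolding S(3) using finS pr by (rule prime_factors_Prod_primes)
    have "S \<noteq> {}" using False S(3) by auto
    hence "Max S \<in> S" using finS by (intro Max_in)
    thus ?thesis using False Q S(1) by (auto simp: gpf_def pf)
  qed (use z in \<open>auto simp: gpf_def\<close>)
  show "coprime d e" unfolding S(3)
  proof (intro prod_coprime_left)
    fix q assume "q \<in> S"
    hence "prime q" "\<not> q dvd e" using Q S(1) by blast+
    thus "coprime q e" by (rule prime_imp_coprime)
  qed
qed

text \<open>The error term bounds the discarded \<open>k\<close>, those with more than
  \<open>y\<close> prime factors.\<close>

lemma card_good_cofactors:
  fixes Z y :: real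
  assumes Z: "Z \<ge> 1" and y: "y \<ge> 0"
  shows "real (card {k\<in>{1..nat \<lfloor>Z\<rfloor>}. T k})
     \<le> real (card {k\<in>{1..nat \<lfloor>Z\<rfloor>}. T k \<and> real (card (prime_factors k)) \<le> y}) + Z * (1 + ln Z) * 2 powr (- y)"
proof -
  define n where "n = nat \<lfloor>Z\<rfloor>"
  \<comment> \<open>The least integer exceeding \<open>y\<close>, so that
    \<open>2 powr y \<le> 2 ^ m\<close>.\<close>
  define m where "m = nat \<lfloor>y\<rfloor> + 1"
  have n: "n > 0" "real n \<le> Z" using Z by (auto simp: n_def le_nat_iff)
  have "{k\<in>{1..n}. T k} \<subseteq> {k\<in>{1..n}. T k \<and> real (card (prime_factors k)) \<le> y} \<union> {k\<in>{1..n}. m \<le> card (prime_factors k)}"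
    unfolding m_def using y by (auto simp: not_le) linarith
  hence "card {k\<in>{1..n}. T k} \<le> card ({k\<in>{1..n}. T k \<and> real (card (prime_factors k)) \<le> y} \<union> {k\<in>{1..n}. m \<le> card (prime_factors k)})"
    by (intro card_mono) auto
  also have "\<dots> \<le> card {k\<in>{1..n}. T k \<and> real (card (prime_factors k)) \<le> y} + card {k\<in>{1..n}. m \<le> card (prime_factors k)}"
    by (rule card_Un_le)
  finally have "real (card {k\<in>{1..n}. T k}) \<le> real (card {k\<in>{1..n}. T k \<and> real (card (prime_factors k)) \<le> y}) + real (card {k\<in>{1..n}. m \<le> card (prime_factors k)})"
    by linarith
  moreover have "real (card {k\<in>{1..n}. m \<le> card (prime_factors k)}) \<le> Z * (1 + ln Z) * 2 powr (- y)"
  proof -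
    have "2 powr y \<le> 2 powr real m" unfolding m_def by (intro powr_mono) linarith+
    hence "2 powr y * real (card {k\<in>{1..n}. m \<le> card (prime_factors k)}) \<le> 2 ^ m * real (card {k\<in>{1..n}. m \<le> card (prime_factors k)})"
      by (intro mult_right_mono) (auto simp: powr_realpow)
    also have "\<dots> \<le> real n * (1 + ln (real n))" using n(1) by (rule card_many_prime_factors)
    also have "\<dots> \<le> Z * (1 + ln Z)" using n Z by (intro mult_mono) auto
    finally show ?thesis by (simp add: powr_minus field_simps)
  qed
  ultimately show ?thesis by (simp add: n_def)
qed

text \<open>For \<open>x = exp (y powr b)\<close> the products \<open>d\<close> of \<open>u\<close>
  primes number at least \<open>(card Q / u) ^ u\<close>, with
  \<open>card Q \<ge> y powr (\<theta> - \<eta>)\<close> and \<open>u\<close> about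
  \<open>B * y powr b / (\<theta> * ln y)\<close>. This is roughly
  \<open>exp (B * (\<theta> - \<eta> - b) / \<theta> * y powr b)\<close>, and the smaller \<rho>
  absorbs the losses in averaging over \<open>k\<close>.\<close>

lemma exists_progression_primes:
  fixes A A' B E b \<eta> \<theta> \<rho> :: real
  assumes A: "A > 0" and BFM: "BFM_const c" and B: "B \<in> B_set c A A'" and E: "E \<in> E_set"
    and \<theta>: "\<theta> = 1 / (1 - E)" and b: "b > 1" and \<eta>: "\<eta> > 0" "b + \<eta> < \<theta>"
    and \<rho>: "0 < \<rho>" "\<rho> < B * (\<theta> - \<eta> - b) / \<theta>"
  shows "eventually (\<lambda>y. \<exists>Q P k. finite Q \<and>
      (\<forall>q\<in>Q. prime q \<and> q mod 4 = 1 \<and> real q \<le> y powr \<theta> \<and> real (gpf (q - 1)) \<le> y) \<and>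
      inS k \<and> real k \<le> exp ((1 - B) * y powr b) \<and> real (card (prime_factors k)) \<le> y \<and> finite P \<and>
      (\<forall>p\<in>P. prime p \<and> p \<notin> Q \<and> real p \<le> 3 * exp (y powr b) \<and> (\<exists>d. d dvd \<Prod>Q \<and> p = 2 * d * k + 1)) \<and>
      exp (\<rho> * y powr b) \<le> real (card P)) at_top"
proof -
  have B01: "0 < B" "B < 1" using B by (auto simp: B_set_def)
  have \<theta>0: "\<theta> > 1" using b \<eta> by linarith
  obtain x0 where x0: "\<And>x d. x \<ge> x0 \<Longrightarrow> inS d \<and> squarefree d \<and> real d \<le> x powr B \<and>
           real (gpf d) \<le> x powr (B / log2 x) \<and> coprime d (exc_mod c (x powr B)) \<Longrightarrow>
           x powr (1 - B) \<le> A * (ln x * sqrt (ln x)) *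
             real (card {k\<in>{1..nat \<lfloor>x powr (1 - B)\<rfloor>}. inS k \<and> prime (2 * d * k + 1)})"
    using B_set_lower_bound[OF A B] by blast
  have "eventually (\<lambda>y. real (card (shifted_smooth_primes (y powr \<theta>) y)) \<ge> y powr (\<theta> - \<eta> / 2)) at_top"
    using \<eta> by (intro card_shifted_smooth_primes_lower_bound[OF A B E _ \<theta>]) simp
  \<comment> \<open>The subtracted term bounds the number of prime divisors of the exceptional
    modulus, which is at most \<open>x powr B\<close>.\<close>
  moreover have "eventually (\<lambda>y. y powr (\<theta> - \<eta> / 2) - 2 * B * y powr b \<ge> y powr (\<theta> - \<eta>)) at_top"
    using b \<eta> \<theta>0 B01 by real_asymp
  moreover have "eventually (\<lambda>y::real. y \<ge> 3) at_top" by (rule eventually_ge_at_top)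
  moreover have "eventually (\<lambda>y. exp (B * y powr b) \<ge> 3) at_top" using B01 b by real_asymp
  moreover have "eventually (\<lambda>y. exp (y powr b) \<ge> x0) at_top" using b by real_asymp
  \<comment> \<open>Here \<open>log2 x = b * ln y\<close>, so this places the primes of
    \<open>Q\<close> below \<open>x powr (B / log2 x)\<close>.\<close>
  moreover have "eventually (\<lambda>y. y powr \<theta> \<le> exp (B * y powr b / (b * ln y))) at_top"
    using b \<theta>0 B01 by real_asymp
  moreover have "eventually (\<lambda>y. b * ln y \<ge> 1) at_top" using b by real_asymp
  \<comment> \<open>As \<open>ln x = y powr b\<close>, the hypothesis on \<open>B\<close> loses
    \<open>y powr (3 * b / 2)\<close> up to a constant; cofactors with too many prime factors are
    exponentially rare, so the proportion \<open>y powr (-2 * b)\<close> survives.\<close>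
  moreover have "eventually (\<lambda>y. 1 / (A * (y powr b * sqrt (y powr b))) - (1 + (1 - B) * y powr b) * 2 powr (-y) \<ge> y powr (-2*b)) at_top"
    using A B01 b by real_asymp
  moreover have "eventually (\<lambda>y. exp ((B * (\<theta> - \<eta> - b) / \<theta>) * y powr b - (\<theta> - \<eta> - b) * ln y) * y powr (-2*b) - y powr \<theta> \<ge> exp (\<rho> * y powr b)) at_top"
  proof -
    define B' K where "B' = B * (\<theta> - \<eta> - b) / \<theta>" and "K = \<theta> - \<eta> - b"
    have "0 < K" "0 < B'" "\<rho> < B'" using \<eta> \<rho> by (auto simp: B'_def K_def)
    thus ?thesis unfolding B'_def[symmetric] unfolding K_def[symmetric] using b \<theta>0 \<rho> by real_asymp
  qed
  moreover have "eventually (\<lambda>y. B * y powr b / (\<theta> * ln y) \<ge> 1) at_top" using B01 b \<theta>0 by real_asymp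
  moreover have "eventually (\<lambda>y. B * y powr b / (\<theta> * ln y) \<le> y powr b) at_top" using B01 b \<theta>0 by real_asymp
  ultimately show ?thesis
  proof eventually_elim
    case (elim y)
    define x where "x = exp (y powr b)"
    define z where "z = y powr \<theta>"
    define Z where "Z = x powr (1 - B)"
    define e where "e = exc_mod c (x powr B)"
    define Q where "Q = {q \<in> shifted_smooth_primes z y. \<not> q dvd e}"
    \<comment> \<open>The largest \<open>u\<close> with \<open>z ^ u \<le> x powr B\<close>, which
      keeps \<open>d\<close> in the admissible range.\<close>
    define u where "u = nat \<lfloor>B * y powr b / (\<theta> * ln y)\<rfloor>"
    define D where "D = prime_products Q u"
    have y: "y \<ge> 3" by fact
    have lny: "ln y > 0" using y by simp
    have z1: "z \<ge> 1" unfolding z_def using y \<theta>0 by (intro ge_one_powr_ge_zero) auto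
    have yb1: "y powr b \<ge> 1" using y b by (intro ge_one_powr_ge_zero) auto
    have xB: "x powr B = exp (B * y powr b)" by (simp add: x_def exp_powr_real mult.commute)
    have Zexp: "Z = exp ((1 - B) * y powr b)" by (simp add: Z_def x_def exp_powr_real mult.commute)
    have Z1: "Z \<ge> 1" using B01 by (simp add: Zexp)
    have lnx: "ln x = y powr b" by (simp add: x_def)
    have log2x: "log2 x = b * ln y"
    proof -
      have "log1 x = y powr b" using yb1 by (simp add: log1_def lnx)
      thus ?thesis using elim y by (simp add: log2_def log1_def ln_powr)
    qed
    have finQ: "finite Q" by (simp add: Q_def finite_shifted_smooth_primes)
    have Q: "prime q \<and> q mod 4 = 1 \<and> real q \<le> z \<and> \<not> q dvd e" "real (gpf (q - 1)) \<le> y" if "q \<in> Q" for q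
      using that by (auto simp: Q_def shifted_smooth_primes_def)
    have e: "e \<ge> 1" "real e \<le> exp (B * y powr b)"
      using exc_mod_bounds[OF BFM, of "x powr B"] elim by (auto simp: e_def xB)
    have cardQ: "real (card Q) \<ge> y powr (\<theta> - \<eta>)"
    proof -
      have "shifted_smooth_primes z y \<subseteq> Q \<union> prime_factors e"
        using e(1) by (auto simp: Q_def shifted_smooth_primes_def in_prime_factors_iff)
      hence "card (shifted_smooth_primes z y) \<le> card (Q \<union> prime_factors e)"
        using finQ by (intro card_mono) auto
      also have "\<dots> \<le> card Q + card (prime_factors e)" by (rule card_Un_le)
      finally have "real (card (shifted_smooth_primes z y)) \<le> real (card Q) + real (card (prime_factors e))" by linarith
      moreover have "real (card (prime_factors e)) \<le> 2 * ln (real e)"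
        using e(1) by (intro card_prime_factors_le_ln) auto
      moreover have "ln (real e) \<le> B * y powr b" using e by (metis ln_exp ln_mono less_le_trans of_nat_0_less_iff zero_less_one)
      ultimately show ?thesis using elim unfolding z_def by linarith
    qed
    have u: "real u \<le> B * y powr b / (\<theta> * ln y)" "real u \<ge> B * y powr b / (\<theta> * ln y) - 1" "u \<ge> 1"
      using elim(10) unfolding u_def by linarith+
    have zu: "z ^ u \<le> x powr B"
    proof -
      have "z ^ u = exp (real u * (\<theta> * ln y))"
        using y by (simp add: z_def powr_def exp_of_nat_mult)
      also have "\<dots> \<le> exp (B * y powr b)"
        using u(1) lny \<theta>0 by (simp add: field_simps)
      finally show ?thesis by (simp add: xB)
    qed
    have zg: "z \<le> x powr (B / log2 x)"
      using elim by (simp add: z_def x_def exp_powr_real log2x[unfolded x_def] mult_ac)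
    have D: "inS d" "squarefree d" "real d \<le> x powr B" "real (gpf d) \<le> x powr (B / log2 x)" "coprime d e" "d dvd \<Prod>Q"
      if "d \<in> D" for d
    proof -
      note * = prime_products_properties[OF finQ Q(1) z1 that[unfolded D_def]]
      show "inS d" "squarefree d" "coprime d e" "d dvd \<Prod>Q" using * by auto
      show "real d \<le> x powr B" "real (gpf d) \<le> x powr (B / log2 x)" using *(3,4) zu zg by linarith+
    qed
    have finD: "finite D" unfolding D_def using finQ by (rule finite_prime_products)
    \<comment> \<open>The restriction is imposed before averaging, so that the popular
      \<open>k\<close> inherits it.\<close>
    define G where "G = {k\<in>{1..nat \<lfloor>Z\<rfloor>}. inS k \<and> real (card (prime_factors k)) \<le> y}"
    have finG: "finite G" by (simp add: G_def)
    have cardG: "real (card G) \<le> Z"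
    proof -
      have "card G \<le> card {1..nat \<lfloor>Z\<rfloor>}" by (intro card_mono) (auto simp: G_def)
      thus ?thesis using Z1 by simp linarith
    qed
    have many: "Z * y powr (-2*b) \<le> real (card {k\<in>G. prime (2 * d * k + 1)})" if d: "d \<in> D" for d
    proof -
      have *: "Z \<le> A * (y powr b * sqrt (y powr b)) *
             real (card {k\<in>{1..nat \<lfloor>Z\<rfloor>}. inS k \<and> prime (2 * d * k + 1)})"
        using x0[of x d] elim D[OF d] unfolding x_def[symmetric] lnx Z_def[symmetric] e_def by blast
      have "Z * (1 / (A * (y powr b * sqrt (y powr b)))) \<le> real (card {k\<in>{1..nat \<lfloor>Z\<rfloor>}. inS k \<and> prime (2 * d * k + 1)})"
      proof -
        have "A * (y powr b * sqrt (y powr b)) > 0" using A y by simp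
        with * show ?thesis by (simp add: pos_divide_le_eq mult.commute)
      qed
      also have "\<dots> \<le> real (card {k\<in>{1..nat \<lfloor>Z\<rfloor>}. (inS k \<and> prime (2 * d * k + 1)) \<and> real (card (prime_factors k)) \<le> y}) + Z * (1 + ln Z) * 2 powr (- y)"
        using Z1 y by (intro card_good_cofactors) auto
      also have "{k\<in>{1..nat \<lfloor>Z\<rfloor>}. (inS k \<and> prime (2 * d * k + 1)) \<and> real (card (prime_factors k)) \<le> y} = {k\<in>G. prime (2 * d * k + 1)}"
        by (auto simp: G_def)
      also have "ln Z = (1 - B) * y powr b" by (simp add: Zexp)
      finally have "Z * (1 / (A * (y powr b * sqrt (y powr b))) - (1 + (1 - B) * y powr b) * 2 powr (-y)) \<le> real (card {k\<in>G. prime (2 * d * k + 1)})"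
        by (simp add: algebra_simps)
      moreover have "Z * y powr (-2*b) \<le> Z * (1 / (A * (y powr b * sqrt (y powr b))) - (1 + (1 - B) * y powr b) * 2 powr (-y))"
        using elim Z1 by (intro mult_left_mono) auto
      ultimately show ?thesis by linarith
    qed
    have u_le: "u \<le> card Q" "real u \<le> y powr b"
    proof -
      show *: "real u \<le> y powr b" using u(1) elim by linarith
      have "y powr b \<le> y powr (\<theta> - \<eta>)" using y \<eta> by (intro powr_mono) auto
      thus "u \<le> card Q" using * cardQ by linarith
    qed
    \<comment> \<open>The term with \<open>ln y\<close> pays for the rounding in
      \<open>u\<close>.\<close>
    have cardD: "exp ((B * (\<theta> - \<eta> - b) / \<theta>) * y powr b - (\<theta> - \<eta> - b) * ln y) \<le> real (card D)"
    proof -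
      have "(B * (\<theta> - \<eta> - b) / \<theta>) * y powr b - (\<theta> - \<eta> - b) * ln y
              = ((\<theta> - \<eta> - b) * ln y) * (B * y powr b / (\<theta> * ln y) - 1)"
        using lny \<theta>0 by (simp add: field_simps)
      also have "\<dots> \<le> ((\<theta> - \<eta> - b) * ln y) * real u"
        using u(2) lny \<eta> by (intro mult_left_mono) auto
      finally have "exp ((B * (\<theta> - \<eta> - b) / \<theta>) * y powr b - (\<theta> - \<eta> - b) * ln y) \<le> exp (((\<theta> - \<eta> - b) * ln y) * real u)"
        by simp
      also have "\<dots> = (y powr (\<theta> - \<eta> - b)) ^ u"
        using y by (simp add: powr_def exp_of_nat_mult mult.commute)
      also have "\<dots> = (y powr (\<theta> - \<eta>) / y powr b) ^ u" by (simp add: powr_diff)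
      also have "\<dots> \<le> (real (card Q) / real u) ^ u"
        using cardQ u_le(2) u(3) by (intro power_mono frac_le) auto
      also have "\<dots> \<le> real (card Q choose u)" using u_le(1) by (rule binomial_ge_n_over_k_pow_k)
      also have "card Q choose u = card D" unfolding D_def
        using card_prime_products[OF finQ] Q(1) by simp
      finally show ?thesis .
    qed
    have "0 < real (card D)" using cardD by (rule less_le_trans[OF exp_gt_zero])
    hence "card D > 0" by simp
    then obtain d0 where "d0 \<in> D" by (metis card_gt_0_iff all_not_in_conv)
    have Gne: "G \<noteq> {}"
    proof
      assume "G = {}"
      hence "Z * y powr (-2*b) \<le> 0" using many[OF \<open>d0 \<in> D\<close>] by simp
      moreover have "0 < Z * y powr (-2*b)" using Z1 y by simp
      ultimately show False by linarith
    qed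
    obtain k where k: "k \<in> G" "Z * y powr (-2*b) * real (card D) \<le> real (card G) * real (card {d\<in>D. prime (2 * d * k + 1)})"
      using exists_popular_element[where R = "\<lambda>d k. prime (2 * d * k + 1)", OF finD finG Gne many] by blast
    have k0: "k > 0" using k(1) by (auto simp: G_def)
    have kZ: "real k \<le> Z" using k(1) Z1 by (auto simp: G_def le_nat_iff) linarith
    have "Z * (y powr (-2*b) * real (card D)) \<le> Z * real (card {d\<in>D. prime (2 * d * k + 1)})"
    proof -
      have "real (card G) * real (card {d\<in>D. prime (2 * d * k + 1)}) \<le> Z * real (card {d\<in>D. prime (2 * d * k + 1)})"
        using cardG by (intro mult_right_mono) auto
      thus ?thesis using k(2) by (simp add: mult.assoc)
    qed
    hence pop: "y powr (-2*b) * real (card D) \<le> real (card {d\<in>D. prime (2 * d * k + 1)})"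
      by (rule mult_left_le_imp_le) (use Z1 in simp)
    \<comment> \<open>Primes of \<open>Q\<close> are removed because they are not units modulo
      \<open>2 * k * \<Prod>Q\<close>; at most \<open>y powr \<theta>\<close> are lost.\<close>
    define P where "P = (\<lambda>d. 2 * d * k + 1) ` {d\<in>D. prime (2 * d * k + 1)} - Q"
    have finP: "finite P" using finD by (simp add: P_def)
    have P: "prime p \<and> p \<notin> Q \<and> real p \<le> 3 * exp (y powr b) \<and> (\<exists>d. d dvd \<Prod>Q \<and> p = 2 * d * k + 1)" if p: "p \<in> P" for p
    proof -
      obtain d where d: "d \<in> D" "prime (2 * d * k + 1)" "p = 2 * d * k + 1" "p \<notin> Q" using p by (auto simp: P_def)
      have "real d * real k \<le> x powr B * Z" using D(3)[OF d(1)] kZ by (intro mult_mono) auto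
      also have "\<dots> = x" by (simp add: Z_def powr_add[symmetric] x_def)
      finally have "real d * real k \<le> x" .
      moreover have "x \<ge> 1" using yb1 by (simp add: x_def)
      moreover have "real p = 2 * (real d * real k) + 1" by (simp add: d(3))
      ultimately have "real p \<le> 3 * x" by linarith
      hence "real p \<le> 3 * exp (y powr b)" by (simp add: x_def)
      thus ?thesis using d D(6)[OF d(1)] by blast
    qed
    have "inj_on (\<lambda>d. 2 * d * k + 1) {d\<in>D. prime (2 * d * k + 1)}"
      using k0 by (auto intro!: inj_onI)
    hence "card {d\<in>D. prime (2 * d * k + 1)} = card ((\<lambda>d. 2 * d * k + 1) ` {d\<in>D. prime (2 * d * k + 1)})"
      by (rule card_image[symmetric])
    also have "\<dots> \<le> card (P \<union> Q)" using finP finQ by (intro card_mono) (auto simp: P_def)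
    also have "\<dots> \<le> card P + card Q" by (rule card_Un_le)
    finally have "real (card {d\<in>D. prime (2 * d * k + 1)}) \<le> real (card P) + real (card Q)" by linarith
    moreover have "real (card Q) \<le> y powr \<theta>"
    proof -
      have "card Q \<le> card {1..nat \<lfloor>z\<rfloor>}"
        using shifted_smooth_primes_subset[of z y] by (intro card_mono) (auto simp: Q_def)
      thus ?thesis using z1 unfolding z_def by simp linarith
    qed
    moreover have "exp ((B * (\<theta> - \<eta> - b) / \<theta>) * y powr b - (\<theta> - \<eta> - b) * ln y) * y powr (-2*b) \<le> y powr (-2*b) * real (card D)"
      using cardD by (subst mult.commute) (intro mult_left_mono, auto)
    ultimately have "exp (\<rho> * y powr b) \<le> real (card P)" using pop elim by linarith
    moreover have "inS k" "real (card (prime_factors k)) \<le> y" using k(1) by (simp_all add: G_def)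
    moreover have "\<forall>q\<in>Q. prime q \<and> q mod 4 = 1 \<and> real q \<le> y powr \<theta> \<and> real (gpf (q - 1)) \<le> y"
      using Q unfolding z_def by blast
    moreover have "\<forall>p\<in>P. prime p \<and> p \<notin> Q \<and> real p \<le> 3 * exp (y powr b) \<and> (\<exists>d. d dvd \<Prod>Q \<and> p = 2 * d * k + 1)"
      using P by (intro ballI)
    moreover note finQ finP kZ[unfolded Zexp]
    ultimately show ?case
      by (intro exI[of _ Q] exI[of _ P] exI[of _ k] conjI)
  qed
qed

section \<open>The lower bound\<close>

lemma Prod_le_powr:
  fixes z w :: real
  assumes "finite S" "\<And>q. q \<in> S \<Longrightarrow> real q \<le> z" "real (card S) \<le> w" "z \<ge> 1"
  shows "real (\<Prod>S) \<le> z powr w"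
proof -
  have "real (\<Prod>S) = (\<Prod>q\<in>S. real q)" by simp
  also have "\<dots> \<le> (\<Prod>q\<in>S. z)" by (intro prod_mono) (use assms in auto)
  also have "\<dots> = z powr real (card S)" using assms by (simp add: powr_realpow)
  also have "\<dots> \<le> z powr w" using assms by (intro powr_mono) auto
  finally show ?thesis .
qed

text \<open>With about \<open>exp (y powr a) / y powr b\<close> primes per product,
  \<open>(card P / t) ^ t\<close> has logarithm at least \<open>\<rho> * exp (y powr a)\<close> to
  leading order: \<open>ln t \<le> y powr a\<close> is negligible against \<open>y powr b\<close>,
  because \<open>b > a\<close>. The logarithm of \<open>(card P + 1) ^ n\<close> is only the
  exponential of a multiple of \<open>y * ln y\<close>, negligible because
  \<open>a > 1\<close>.\<close>

lemma C_count_lower_bound_exp: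
  fixes A A' B E \<epsilon> :: real
  assumes A: "A > 0" and BFM: "BFM_const c" and B: "B \<in> B_set c A A'" and E: "E \<in> E_set"
    and \<epsilon>: "0 < \<epsilon>" "\<epsilon> < E * B"
  shows "eventually (\<lambda>y. exp ((E * B - \<epsilon>) * exp (y powr (1 + \<epsilon> / 8)))
           \<le> real (C_count (exp (exp (y powr (1 + \<epsilon> / 8)))))) at_top"
proof -
  have B01: "0 < B" "B < 1" using B by (auto simp: B_set_def)
  have E01: "0 < E" "E < 1" using E by (auto simp: E_set_def)
  define \<eta> where "\<eta> = \<epsilon> / 8"
  define a where "a = 1 + \<eta>"
  define b where "b = 1 + 2 * \<eta>"
  define \<theta> where "\<theta> = 1 / (1 - E)"
  define \<rho> where "\<rho> = E * B - \<epsilon> / 2"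
  define \<tau> where "\<tau> = E * B - \<epsilon>"
  have \<eta>: "\<eta> > 0" using \<epsilon> by (simp add: \<eta>_def)
  have ab: "a > 1" "b > a" "b > 1" using \<eta> by (auto simp: a_def b_def)
  have \<theta>0: "\<theta> > 0" using E01 by (simp add: \<theta>_def)
  have \<tau>\<rho>: "0 < \<tau>" "\<tau> < \<rho>" "0 < \<rho>" using \<epsilon> by (auto simp: \<tau>_def \<rho>_def)
  \<comment> \<open>Since \<open>\<theta> - 1 = E * \<theta>\<close>, the admissible exponent equals
    \<open>E * B - 3 * \<eta> * (B * (1 - E))\<close>; as
    \<open>3 * \<eta> = 3 * \<epsilon> / 8\<close> is less than \<open>\<epsilon> / 2\<close>,
    \<rho> stays below it.\<close>
  have "B * (1 - E) < 1 * 1" using B01 E01 by (intro mult_strict_mono) auto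
  hence "3 * \<eta> * (B * (1 - E)) < 3 * \<eta> * 1" using \<eta> by (intro mult_strict_left_mono) auto
  hence "\<rho> < E * B - 3 * \<eta> * (B * (1 - E))" using \<epsilon> by (simp add: \<rho>_def \<eta>_def)
  also have "\<dots> = B * (\<theta> - \<eta> - b) / \<theta>"
    using E01 by (simp add: \<theta>_def b_def field_simps)
  finally have \<rho>_less: "\<rho> < B * (\<theta> - \<eta> - b) / \<theta>" .
  hence "0 < B * (\<theta> - \<eta> - b) / \<theta>" using \<tau>\<rho> by linarith
  hence b\<theta>: "b + \<eta> < \<theta>" using B01 \<theta>0 by (simp add: zero_less_mult_iff zero_less_divide_iff)
  have "eventually (\<lambda>y. \<exists>Q P k. finite Q \<and>
      (\<forall>q\<in>Q. prime q \<and> q mod 4 = 1 \<and> real q \<le> y powr \<theta> \<and> real (gpf (q - 1)) \<le> y) \<and>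
      inS k \<and> real k \<le> exp ((1 - B) * y powr b) \<and> real (card (prime_factors k)) \<le> y \<and> finite P \<and>
      (\<forall>p\<in>P. prime p \<and> p \<notin> Q \<and> real p \<le> 3 * exp (y powr b) \<and> (\<exists>d. d dvd \<Prod>Q \<and> p = 2 * d * k + 1)) \<and>
      exp (\<rho> * y powr b) \<le> real (card P)) at_top"
    by (rule exists_progression_primes[OF A BFM B E \<theta>_def ab(3) \<eta> b\<theta> \<tau>\<rho>(3) \<rho>_less])
  \<comment> \<open>Main term minus loss, in logarithms: the lower bound for \<open>t\<close> times
    that for \<open>ln (card P / t)\<close>, against the upper bounds for \<open>n\<close> and
    \<open>ln (card P + 1)\<close>.\<close>
  moreover have "eventually (\<lambda>y. (exp (y powr a) / (y powr b + 2) - 1) * (\<rho> * y powr b - y powr a) - 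
     (exp (2 * y * (\<theta> * ln y)) * (1 + (1-B) * y powr b + y powr \<theta> * (\<theta> * ln y)) + 1) * (y powr b + 2) \<ge> \<tau> * exp (y powr a)) at_top"
    using \<tau>\<rho> ab \<theta>0 B01 by real_asymp
  moreover have "eventually (\<lambda>y. 
     (exp (2 * y * (\<theta> * ln y)) * (1 + (1-B) * y powr b + y powr \<theta> * (\<theta> * ln y)) + 1) + 2 \<le> exp (y powr a) / (y powr b + 2) - 1) at_top"
    using ab \<theta>0 B01 by real_asymp
  moreover have "eventually (\<lambda>y. y powr a \<le> \<rho> * y powr b) at_top"
    using ab \<theta>0 \<tau>\<rho> by real_asymp
  moreover have "eventually (\<lambda>y::real. y \<ge> 1) at_top" by (rule eventually_ge_at_top)
  ultimately have "eventually (\<lambda>y. exp (\<tau> * exp (y powr a)) \<le> real (C_count (exp (exp (y powr a))))) at_top"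
  proof eventually_elim
    case (elim y)
    obtain Q P k where finQ: "finite Q"
      and Q: "\<And>q. q \<in> Q \<Longrightarrow> prime q \<and> q mod 4 = 1 \<and> real q \<le> y powr \<theta> \<and> real (gpf (q - 1)) \<le> y"
      and k: "inS k" "real k \<le> exp ((1 - B) * y powr b)" "real (card (prime_factors k)) \<le> y" and finP: "finite P"
      and P: "\<And>p. p \<in> P \<Longrightarrow> prime p \<and> p \<notin> Q \<and> real p \<le> 3 * exp (y powr b) \<and> (\<exists>d. d dvd \<Prod>Q \<and> p = 2 * d * k + 1)"
      and r: "exp (\<rho> * y powr b) \<le> real (card P)"
      using elim(1) by metis
    have y: "y \<ge> 1" by fact
    define z where "z = y powr \<theta>"
    have z1: "z \<ge> 1" unfolding z_def using y \<theta>0 by (intro ge_one_powr_ge_zero) auto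
    have lnz: "ln z = \<theta> * ln y" using y by (simp add: z_def ln_powr)
    have "q \<ge> 2" if "q \<in> Q" for q using Q[OF that] prime_ge_2_nat by blast
    then obtain l where l: "l > 0" "real l \<le> z powr y" "\<And>q. q \<in> Q \<Longrightarrow> (q - 1) dvd l"
      using exists_smooth_exponent[OF y z1 finQ] Q unfolding z_def by blast
    define g where "g = \<Prod>{q\<in>Q. q dvd k}"
    define N where "N = 2 * k * \<Prod>Q"
    define M where "M = exp (2 * y * (\<theta> * ln y)) * (1 + (1-B) * y powr b + y powr \<theta> * (\<theta> * ln y))"
    \<comment> \<open>The added 1 makes the inequality strict, as the existence of unit subproducts
      demands.\<close>
    define n where "n = nat \<lfloor>real (g * l) * ln (real N)\<rfloor> + 1"
    \<comment> \<open>Chosen so that \<open>R ^ t \<le> exp (exp (y powr a))\<close> for the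
      \<open>R\<close> below.\<close>
    define t where "t = nat \<lfloor>exp (y powr a) / (y powr b + 2)\<rfloor>"
    have k0: "k > 0" using k(1) by (simp add: inS_def)
    have Qpos: "\<Prod>Q > 0" using Q by (auto intro!: prod_pos simp: prime_gt_0_nat)
    have "real g \<le> z powr y"
      unfolding g_def
    proof (rule Prod_le_powr)
      have "card {q\<in>Q. q dvd k} \<le> card (prime_factors k)"
        using Q k0 by (intro card_mono) (auto simp: in_prime_factors_iff)
      thus "real (card {q\<in>Q. q dvd k}) \<le> y" using k(3) by linarith
    qed (use finQ Q z1 in \<open>auto simp: z_def\<close>)
    hence "real g * real l \<le> z powr y * z powr y" using l(2) by (intro mult_mono) auto
    also have "\<dots> = exp (2 * y * (\<theta> * ln y))"
      using z1 by (simp add: powr_add[symmetric]) (simp add: powr_def lnz)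
    finally have gl: "real (g * l) \<le> exp (2 * y * (\<theta> * ln y))" by simp
    have "Q \<subseteq> {1..nat \<lfloor>z\<rfloor>}"
      using Q prime_ge_1_nat by (auto simp: z_def le_nat_floor)
    hence "card Q \<le> card {1..nat \<lfloor>z\<rfloor>}" by (intro card_mono) auto
    hence cardQ: "real (card Q) \<le> z" using z1 by simp linarith
    have Qz: "real (\<Prod>Q) \<le> z powr z"
      by (rule Prod_le_powr) (use finQ Q z1 cardQ in \<open>auto simp: z_def\<close>)
    have Qpos': "real (\<Prod>Q) > 0" using Qpos by (simp only: of_nat_0_less_iff)
    have lnQ: "ln (real (\<Prod>Q)) \<le> ln (z powr z)" by (rule ln_mono[OF Qz Qpos'])
    have "ln (real k) \<le> ln (exp ((1 - B) * y powr b))" using k(2) k0 by (intro ln_mono) auto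
    moreover have "ln (real N) = ln 2 + ln (real k) + ln (real (\<Prod>Q))"
    proof -
      have "ln (2 * v * w) = ln 2 + ln v + ln w" if "v > 0" "w > 0" for v w :: real
        using that by (simp add: ln_mult)
      from this[OF _ Qpos', of "real k"] k0 show ?thesis
        unfolding N_def of_nat_mult of_nat_numeral by (simp only: of_nat_0_less_iff)
    qed
    moreover have "ln (2::real) \<le> 1" using ln_2_less_1 by simp
    ultimately have lnN: "ln (real N) \<le> 1 + (1-B) * y powr b + y powr \<theta> * (\<theta> * ln y)"
      using lnQ z1 by (simp add: ln_powr lnz) (simp add: z_def)
    have "N > 0" using k0 Qpos by (simp add: N_def)
    hence lnN0: "ln (real N) \<ge> 0" by simp
    have "real (g * l) * ln (real N) \<le> M"
      unfolding M_def using gl lnN lnN0 by (intro mult_mono) auto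
    moreover have "0 \<le> real (g * l) * ln (real N)" using lnN0 by simp
    ultimately have n: "real n > real (g * l) * ln (real N)" "real n \<le> M + 1"
      unfolding n_def by linarith+
    have yb0: "y powr b + 2 > 0" by (simp add: add_nonneg_pos)
    have t_le: "real t \<le> exp (y powr a) / (y powr b + 2)" and t_ge: "real t \<ge> exp (y powr a) / (y powr b + 2) - 1"
      using yb0 unfolding t_def by (auto intro: of_nat_floor)
    have tn: "t \<ge> n + 2" using n(2) t_ge elim(3) unfolding M_def by linarith
    have t_exp: "real t \<le> exp (y powr a)"
    proof -
      have "exp (y powr a) / (y powr b + 2) \<le> exp (y powr a) / 1"
        by (intro divide_left_mono) (auto simp: yb0)
      thus ?thesis using t_le by linarith
    qed
    \<comment> \<open>By \<open>exp 2 \<ge> 4\<close>, the summand 2 lets \<open>R\<close> bound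
      both the primes in \<open>P\<close>, at most \<open>3 * exp (y powr b)\<close>, and
      \<open>card P + 1\<close>.\<close>
    define R where "R = exp (y powr b + 2)"
    have "(4::real) = 2 * 2" by simp
    also have "\<dots> \<le> exp 1 * exp 1" using exp_ge_add_one_self[of 1] by (intro mult_mono) auto
    also have "\<dots> = exp (2::real)" by (simp add: exp_add[symmetric])
    finally have "4 * exp (y powr b) \<le> R" unfolding R_def by (simp add: exp_add mult.commute)
    hence R: "3 * exp (y powr b) + 1 \<le> R" using exp_ge_add_one_self[of "y powr b"] powr_ge_zero[of y b] by linarith
    have "P \<subseteq> {1..nat \<lfloor>3 * exp (y powr b)\<rfloor>}"
      using P prime_ge_1_nat by (auto simp: le_nat_floor)
    hence "card P \<le> card {1..nat \<lfloor>3 * exp (y powr b)\<rfloor>}" by (intro card_mono) auto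
    also have "real \<dots> \<le> 3 * exp (y powr b)" by (simp add: of_nat_floor)
    finally have r_le: "real (card P) + 1 \<le> R" using R by linarith
    have "R ^ t = exp (real t * (y powr b + 2))" by (simp add: R_def exp_of_nat_mult)
    also have "\<dots> \<le> exp (exp (y powr a))" using t_le yb0 by (simp add: field_simps)
    finally have Rt: "R ^ t \<le> exp (exp (y powr a))" .
    have "exp (y powr a) \<le> exp (\<rho> * y powr b)" using elim(4) by simp
    hence tr: "t \<le> card P" using t_exp r by linarith
    have "card P choose t \<le> (card P + 1) ^ n * C_count (exp (exp (y powr a)))"
    proof (rule C_count_lower_bound[OF finQ _ l(1) k(1) finP])
      show "real (\<Prod>{q \<in> Q. q dvd k} * l) * ln (real (2 * k * \<Prod>Q)) < real n"
        using n(1) by (simp only: g_def N_def)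
      show "1 \<le> R" by (simp add: R_def)
      fix p assume "p \<in> P"
      thus "prime p \<and> p \<notin> Q \<and> real p \<le> R \<and> (\<exists>d. d dvd \<Prod>Q \<and> p = 2 * d * k + 1)"
        using P[of p] R by auto
    qed (use Q l tn Rt in auto)
    hence "real (card P choose t) \<le> real ((card P + 1) ^ n * C_count (exp (exp (y powr a))))"
      by (simp only: of_nat_le_iff)
    hence up: "real (card P choose t) \<le> (real (card P) + 1) ^ n * real (C_count (exp (exp (y powr a))))"
      by (simp add: add.commute)
    have "exp (\<tau> * exp (y powr a)) * R ^ n \<le> exp (real t * (\<rho> * y powr b - y powr a))"
    proof -
      have "real n * (y powr b + 2) \<le> (M + 1) * (y powr b + 2)"
        using n(2) yb0 by (intro mult_right_mono) auto
      moreover have "(exp (y powr a) / (y powr b + 2) - 1) * (\<rho> * y powr b - y powr a) \<le> real t * (\<rho> * y powr b - y powr a)"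
        using t_ge elim(4) by (intro mult_right_mono) auto
      ultimately have "\<tau> * exp (y powr a) + real n * (y powr b + 2) \<le> real t * (\<rho> * y powr b - y powr a)"
        using elim(2) unfolding M_def by linarith
      moreover have "R ^ n = exp (real n * (y powr b + 2))" by (simp add: R_def exp_of_nat_mult)
      ultimately show ?thesis by (simp add: exp_add[symmetric])
    qed
    also have "\<dots> = (exp (\<rho> * y powr b) / exp (y powr a)) ^ t"
      by (simp add: exp_of_nat_mult exp_diff)
    also have "\<dots> \<le> (real (card P) / real t) ^ t"
      using r t_exp tn by (intro power_mono frac_le) auto
    also have "\<dots> \<le> real (card P choose t)" using tr by (rule binomial_ge_n_over_k_pow_k)
    also note up
    also have "(real (card P) + 1) ^ n * real (C_count (exp (exp (y powr a)))) \<le> R ^ n * real (C_count (exp (exp (y powr a))))"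
      using r_le by (intro mult_right_mono power_mono) auto
    finally have "R ^ n * exp (\<tau> * exp (y powr a)) \<le> R ^ n * real (C_count (exp (exp (y powr a))))"
      by (simp add: mult.commute)
    thus ?case by (rule mult_left_le_imp_le) (simp add: R_def)
  qed
  thus ?thesis by (simp add: a_def \<eta>_def \<tau>_def)
qed

theorem theorem2p4:
  fixes A A' c E B \<epsilon> :: real
  assumes "A > 0" and "A' > 0"
    and "BFM_const c"
    and "E \<in> E_set" and "E > 4/9"
    and "B \<in> B_set c A A'"
    and "\<epsilon> > 0"
  shows "\<exists>x4. \<forall>x \<ge> x4. real (C_count x) \<ge> x powr (E * B - \<epsilon>)"
proof -
  have "E * B > 0" using assms by (simp add: E_set_def B_set_def)
  \<comment> \<open>The estimate along \<open>y\<close> asks for a parameter below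
    \<open>E * B\<close>; replacing a large \<epsilon> by a smaller \<delta> only strengthens the
    bound.\<close>
  define \<delta> where "\<delta> = min \<epsilon> (E * B / 2)"
  have \<delta>: "0 < \<delta>" "\<delta> < E * B" "\<delta> \<le> \<epsilon>" using assms(7) \<open>E * B > 0\<close> by (auto simp: \<delta>_def)
  define a where "a = 1 + \<delta> / 8"
  have a: "a > 0" using \<delta> by (simp add: a_def)
  have "eventually (\<lambda>y. exp ((E * B - \<delta>) * exp (y powr a)) \<le> real (C_count (exp (exp (y powr a))))) at_top"
    unfolding a_def by (rule C_count_lower_bound_exp[OF assms(1,3,6,4) \<delta>(1,2)])
  \<comment> \<open>Substituting \<open>y = ln (ln x) powr (1 / a)\<close> makes the double
    exponential equal to \<open>x\<close>, so every large real \<open>x\<close> is reached.\<close>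
  moreover have "filterlim (\<lambda>x::real. ln (ln x) powr (1 / a)) at_top at_top" using a by real_asymp
  ultimately have "eventually (\<lambda>x. exp ((E * B - \<delta>) * exp ((ln (ln x) powr (1 / a)) powr a))
      \<le> real (C_count (exp (exp ((ln (ln x) powr (1 / a)) powr a))))) at_top"
    by (rule eventually_compose_filterlim)
  moreover have "eventually (\<lambda>x::real. ln (ln x) > 0) at_top" "eventually (\<lambda>x::real. ln x > 0) at_top"
    "eventually (\<lambda>x::real. x > 1) at_top" by real_asymp+
  ultimately have "eventually (\<lambda>x. x powr (E * B - \<epsilon>) \<le> real (C_count x)) at_top"
  proof eventually_elim
    case (elim x)
    have "(ln (ln x) powr (1 / a)) powr a = ln (ln x)" using elim a by (simp add: powr_powr)
    hence "exp ((E * B - \<delta>) * ln x) \<le> real (C_count x)" using elim by simp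
    moreover have "x powr (E * B - \<epsilon>) \<le> x powr (E * B - \<delta>)"
      using elim \<delta> by (intro powr_mono) auto
    moreover have "x powr (E * B - \<delta>) = exp ((E * B - \<delta>) * ln x)"
      using elim by (simp add: powr_def)
    ultimately show ?case by linarith
  qed
  thus ?thesis by (simp add: eventually_at_top_linorder)
qed

end
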